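(* The language $\mathcal{NF}\subseteq\{a,a^{-1},t,t^{-1}\}^*$ of normal forms for $BS(1,2)=\langle a,t\mid tat^{-1}=a^2\rangle$ with the standard generating set $\{a,a^{-1},t,t^{-1}\}$ (defined in the context) is context-free.
   Context: **Normal forms.** Words are over $\{a,a^{-1},t,t^{-1}\}$. The $t$-exponent of a word is the sum of the exponents of its $t^{\pm1}$ letters. An $N$-run is a word $a^{\epsilon_l}t^{-1}a^{\epsilon_{l-1}}t^{-1}\cdots t^{-1}a^{\epsilon_0}$, recorded by its sequence of entries $\epsilon_l\epsilon_{l-1}\cdots\epsilon_0$; a $P$-run is a word $a^{\epsilon_0}ta^{\epsilon_1}t\cdots ta^{\epsilon_l}$, recorded as $\epsilon_0\epsilon_1\cdots\epsilon_l$ (all $\epsilon_i\in\mathbb Z$). "The negative" of a sequence negates all of its entries. When several entries in a list carry $\pm$, all independent sign choices are allowed. The language $\mathcal{NF}$ is the union of the following five families of words ($\epsilon$ denotes the empty word). (1) $\epsilon, a^{\pm1},a^{\pm2},a^{\pm3}$. (2) (types $X$, $XN$, $XNP$; $t$-exponent $\le 0$) Words $t^{k}a^{\epsilon_l}t^{-1}a^{\epsilon_{l-1}}t^{-1}\cdots a^{\epsilon_1}t^{-1}a^{\epsilon_0}t^{m}$ with $k>0$, $m\ge0$, $l\ge k+m$, and $\epsilon_0\ne0$ if $m>0$. If $l\ge3$: the $N$-run starts with one of $200,201,210,300,301,30(-1),310$ or the negative of one of these; all later entries are in $\{0,1,-1\}$; and no two consecutive entries are both nonzero, except possibly within the three-entry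 prefix. If $l\le2$: the word is in $L_1$, the set of words - $ta^it^{-1}a^j$, $ij=(\pm2)0,(\pm3)0,21,31,(-2)(-1),(-3)(-1)$; - $ta^it^{-1}a^jt^{-1}a^k$ and $t^2a^it^{-1}a^jt^{-1}a^k$, $ijk=(\pm2)00,(\pm3)00,201,(\pm3)01,(-2)0(-1),(\pm3)0(-1),210,310,(-2)(-1)0,(-3)(-1)0$; - $ta^it^{-1}a^jt^{-1}a^kt$, $ijk=201,(\pm3)01,(-2)0(-1),(\pm3)0(-1)$. (3) (types $N$, $NP_\le$; $t$-exponent $\le0$) Words $a^{\epsilon_l}t^{-1}a^{\epsilon_{l-1}}t^{-1}\cdots a^{\epsilon_1}t^{-1}a^{\epsilon_0}t^{k}$ with $l\ge1$, $0\le k\le l$, and $\epsilon_0\neq0$ if $k>0$. If $l\ge3$: the $N$-run starts with one of $000,001,010,100,101,10(-1),110,200,201,20(-1),210,300,301,30(-1),310$ or the negative of one of these; all later entries are in $\{0,1,-1\}$; and no two consecutive entries are both nonzero, except possibly within the three-entry prefix. If $l\le 2$: the word is in $L_2$, the set of words - $a^it^{-1}a^j$, $ij=00,(\pm1)0,(\pm2)0,(\pm3)0,0(\pm1),11,21,31,(-1)(-1),(-2)(-1),(-3)(-1)$; - $a^it^{-1}a^jt$, $ij=0(\pm1),11,21,31,(-1)(-1),(-2)(-1),(-3)(-1)$; - $a^it^{-1}a^jt^{-1}a^k$, $ijk=000,(\pm1)00,(\pm2)00,(\pm3)00,0(\pm1)0,00(\pm1),(\pm1)0(\pm1),(\pm2)0(\pm1),(\pm3)0(\pm1),110,210,310,(-1)(-1)0,(-2)(-1)0,(-3)(-1)0$;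 - $a^it^{-1}a^jt^{-1}a^kt$ and $a^it^{-1}a^jt^{-1}a^kt^2$, $ijk=00(\pm1),(\pm1)0(\pm1),(\pm2)0(\pm1),(\pm3)0(\pm1)$. (4) (types $P$, $NP_>$; $t$-exponent $>0$) Words $t^{-k}a^{\epsilon_0}ta^{\epsilon_1}t\cdots a^{\epsilon_{l-1}}ta^{\epsilon_l}$ with $0\le k<l$ and $\epsilon_0\ne0$ if $k>0$. If $l\ge3$: the $P$-run ends with one of $000,100,010,001,101,(-1)01,011,002,102,(-1)02,012,003,103,(-1)03,013$ or the negative of one of these; all earlier entries are in $\{0,1,-1\}$; and no two consecutive entries are both nonzero, except possibly within the three-entry suffix. If $l\le2$: the word is in $L_3$, the set of words - $a^ita^j$, $ij=00,0(\pm1),0(\pm2),0(\pm3),(\pm1)0,11,12,13,(-1)(-1),(-1)(-2),(-1)(-3)$; - $a^ita^jta^k$, $ijk=000,(\pm1)00,00(\pm1),00(\pm2),00(\pm3),(\pm1)0(\pm1),(\pm1)0(\pm2),(\pm1)0(\pm3),0(\pm1)0,011,012,013,0(-1)(-1),0(-1)(-2),0(-1)(-3)$; - $t^{-1}a^ita^jta^k$, $ijk=(\pm1)00,(\pm1)0(\pm1),(\pm1)0(\pm2),(\pm1)0(\pm3)$. (5) (types $PX$, $NPX$; $t$-exponent $>0$) Words $t^{-k}a^{\epsilon_0}ta^{\epsilon_1}t\cdots a^{\epsilon_{l-1}}ta^{\epsilon_l}t^{-m}$ with $k\ge0$, $m>0$, $k+m<l$, and $\epsilon_0\neq0$ if $k>0$.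 If $l\ge3$: the $P$-run ends with one of $002,102,012,003,103,(-1)03,013$ or the negative of one of these; all earlier entries are in $\{0,1,-1\}$; and no two consecutive entries are both nonzero, except possibly within the three-entry suffix. If $l=2$: the word is in $L_4$, the set of words - $a^ita^jta^kt^{-1}$, $ijk=00(\pm2),00(\pm3),012,013,0(-1)(-2),0(-1)(-3),102,10(\pm3),(-1)0(-2),(-1)0(\pm3)$. *)

theory Defs
  imports Main
begin

datatype ('n, 't) sym = Nt 'n | Tm 't

type_synonym ('n, 't) prods = "('n \<times> ('n, 't) sym list) set"

definition deriv_step :: "('n, 't) prods \<Rightarrow> ('n, 't) sym list rel" where
  "deriv_step P = {(u @ [Nt B] @ v, u @ r @ v) | u v B r. (B, r) \<in> P}"

definition Lang :: "('n, 't) prods \<Rightarrow> 'n \<Rightarrow> 't list set" where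
  "Lang P S = {w. ([Nt S], map Tm w) \<in> (deriv_step P)\<^sup>*}"

text \<open>A finite set of productions mentions only finitely many nonterminals, so naming them by
  natural numbers is no restriction.\<close>

definition context_free :: "'t list set \<Rightarrow> bool" where
  "context_free L \<longleftrightarrow> (\<exists>(P :: (nat, 't) prods) S. finite P \<and> L = Lang P S)"

text \<open>The letters stand for the standard generators $a$, $t$ of
  $BS(1,2) = \langle a, t \mid t a t^{-1} = a^2 \rangle$ and their formal inverses. A word is an
  arbitrary list of letters; nothing is cancelled.\<close>

datatype letter = gen_a | gen_a_inv | gen_t | gen_t_inv

definition a_pow :: "int \<Rightarrow> letter list" where
  "a_pow e = (if 0 \<le> e then replicate (nat e) gen_a else replicate (nat (- e)) gen_a_inv)"

fun run :: "letter \<Rightarrow> int list \<Rightarrow> letter list" where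
  "run s [] = []"
| "run s [e] = a_pow e"
| "run s (e # e' # es) = a_pow e @ [s] @ run s (e' # es)"

text \<open>Entries are listed as they occur in the word from left to right, so the entry
  $\epsilon_0$ is the last one of an $N$-run and the first one of a $P$-run. A run with
  entries $\epsilon_0, \dots, \epsilon_l$ has a list of length $l + 1$.\<close>

abbreviation N_run :: "int list \<Rightarrow> letter list" where "N_run \<equiv> run gen_t_inv"
abbreviation P_run :: "int list \<Rightarrow> letter list" where "P_run \<equiv> run gen_t"

definition with_neg :: "int list set \<Rightarrow> int list set" where
  "with_neg A = A \<union> map uminus ` A"

definition pm :: "int \<Rightarrow> int set" where
  "pm x = {x, - x}"

text \<open>Positions 0, 1, 2 form the prefix; a pair of consecutive positions is exempt from the
  sparsity condition only if both of its members lie in the prefix (dually for the suffix).\<close>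

definition N_admissible :: "int list set \<Rightarrow> int list \<Rightarrow> bool" where
  "N_admissible A es \<longleftrightarrow> take 3 es \<in> with_neg A
     \<and> (\<forall>i. 3 \<le> i \<and> i < length es \<longrightarrow> es ! i \<in> {0, 1, -1})
     \<and> (\<forall>i. 3 \<le> Suc i \<and> Suc i < length es \<longrightarrow> es ! i = 0 \<or> es ! Suc i = 0)"

definition P_admissible :: "int list set \<Rightarrow> int list \<Rightarrow> bool" where
  "P_admissible A es \<longleftrightarrow> drop (length es - 3) es \<in> with_neg A
     \<and> (\<forall>i < length es - 3. es ! i \<in> {0, 1, -1})
     \<and> (\<forall>i < length es - 3. es ! i = 0 \<or> es ! Suc i = 0)"

definition L1 :: "letter list set" where
  "L1 =
     (\<lambda>e. [gen_t] @ N_run e) `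
       (listset [pm 2, {0}] \<union> listset [pm 3, {0}] \<union> {[2,1], [3,1], [-2,-1], [-3,-1]})
   \<union> (\<Union>p \<in> {[gen_t], [gen_t, gen_t]}. (\<lambda>e. p @ N_run e) `
       (listset [pm 2, {0}, {0}] \<union> listset [pm 3, {0}, {0}] \<union> {[2,0,1]}
        \<union> listset [pm 3, {0}, {1}] \<union> {[-2,0,-1]} \<union> listset [pm 3, {0}, {-1}]
        \<union> {[2,1,0], [3,1,0], [-2,-1,0], [-3,-1,0]}))
   \<union> (\<lambda>e. [gen_t] @ N_run e @ [gen_t]) `
       ({[2,0,1]} \<union> listset [pm 3, {0}, {1}] \<union> {[-2,0,-1]} \<union> listset [pm 3, {0}, {-1}])"

definition L2 :: "letter list set" where
  "L2 =
     N_run `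
       ({[0,0]} \<union> listset [pm 1, {0}] \<union> listset [pm 2, {0}] \<union> listset [pm 3, {0}]
        \<union> listset [{0}, pm 1] \<union> {[1,1], [2,1], [3,1], [-1,-1], [-2,-1], [-3,-1]})
   \<union> (\<lambda>e. N_run e @ [gen_t]) `
       (listset [{0}, pm 1] \<union> {[1,1], [2,1], [3,1], [-1,-1], [-2,-1], [-3,-1]})
   \<union> N_run `
       ({[0,0,0]} \<union> listset [pm 1, {0}, {0}] \<union> listset [pm 2, {0}, {0}]
        \<union> listset [pm 3, {0}, {0}] \<union> listset [{0}, pm 1, {0}] \<union> listset [{0}, {0}, pm 1]
        \<union> listset [pm 1, {0}, pm 1] \<union> listset [pm 2, {0}, pm 1] \<union> listset [pm 3, {0}, pm 1]
        \<union> {[1,1,0], [2,1,0], [3,1,0], [-1,-1,0], [-2,-1,0], [-3,-1,0]})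
   \<union> (\<Union>q \<in> {[gen_t], [gen_t, gen_t]}. (\<lambda>e. N_run e @ q) `
       (listset [{0}, {0}, pm 1] \<union> listset [pm 1, {0}, pm 1] \<union> listset [pm 2, {0}, pm 1]
        \<union> listset [pm 3, {0}, pm 1]))"

definition L3 :: "letter list set" where
  "L3 =
     P_run `
       ({[0,0]} \<union> listset [{0}, pm 1] \<union> listset [{0}, pm 2] \<union> listset [{0}, pm 3]
        \<union> listset [pm 1, {0}] \<union> {[1,1], [1,2], [1,3], [-1,-1], [-1,-2], [-1,-3]})
   \<union> P_run `
       ({[0,0,0]} \<union> listset [pm 1, {0}, {0}] \<union> listset [{0}, {0}, pm 1]
        \<union> listset [{0}, {0}, pm 2] \<union> listset [{0}, {0}, pm 3] \<union> listset [pm 1, {0}, pm 1]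
        \<union> listset [pm 1, {0}, pm 2] \<union> listset [pm 1, {0}, pm 3] \<union> listset [{0}, pm 1, {0}]
        \<union> {[0,1,1], [0,1,2], [0,1,3], [0,-1,-1], [0,-1,-2], [0,-1,-3]})
   \<union> (\<lambda>e. [gen_t_inv] @ P_run e) `
       (listset [pm 1, {0}, {0}] \<union> listset [pm 1, {0}, pm 1] \<union> listset [pm 1, {0}, pm 2]
        \<union> listset [pm 1, {0}, pm 3])"

definition L4 :: "letter list set" where
  "L4 = (\<lambda>e. P_run e @ [gen_t_inv]) `
     (listset [{0}, {0}, pm 2] \<union> listset [{0}, {0}, pm 3]
      \<union> {[0,1,2], [0,1,3], [0,-1,-2], [0,-1,-3]} \<union> {[1,0,2]} \<union> listset [{1}, {0}, pm 3]
      \<union> {[-1,0,-2]} \<union> listset [{-1}, {0}, pm 3])"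

definition NF1 :: "letter list set" where
  "NF1 = a_pow ` {0, 1, -1, 2, -2, 3, -3}"

definition NF2 :: "letter list set" where
  "NF2 = {replicate k gen_t @ N_run es @ replicate m gen_t | k m l es.
     length es = Suc l \<and> 0 < k \<and> k + m \<le> l \<and> (0 < m \<longrightarrow> last es \<noteq> 0)
     \<and> (if 3 \<le> l
        then N_admissible {[2,0,0], [2,0,1], [2,1,0], [3,0,0], [3,0,1], [3,0,-1], [3,1,0]} es
        else replicate k gen_t @ N_run es @ replicate m gen_t \<in> L1)}"

definition NF3 :: "letter list set" where
  "NF3 = {N_run es @ replicate k gen_t | k l es.
     length es = Suc l \<and> 1 \<le> l \<and> k \<le> l \<and> (0 < k \<longrightarrow> last es \<noteq> 0)
     \<and> (if 3 \<le> l
        then N_admissible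
               {[0,0,0], [0,0,1], [0,1,0], [1,0,0], [1,0,1], [1,0,-1], [1,1,0],
                [2,0,0], [2,0,1], [2,0,-1], [2,1,0], [3,0,0], [3,0,1], [3,0,-1], [3,1,0]} es
        else N_run es @ replicate k gen_t \<in> L2)}"

definition NF4 :: "letter list set" where
  "NF4 = {replicate k gen_t_inv @ P_run es | k l es.
     length es = Suc l \<and> k < l \<and> (0 < k \<longrightarrow> hd es \<noteq> 0)
     \<and> (if 3 \<le> l
        then P_admissible
               {[0,0,0], [1,0,0], [0,1,0], [0,0,1], [1,0,1], [-1,0,1], [0,1,1],
                [0,0,2], [1,0,2], [-1,0,2], [0,1,2], [0,0,3], [1,0,3], [-1,0,3], [0,1,3]} es
        else replicate k gen_t_inv @ P_run es \<in> L3)}"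

text \<open>Here $0 < m$ and $k + m < l$ force $2 \leq l$, so the last alternative is $l = 2$.\<close>

definition NF5 :: "letter list set" where
  "NF5 = {replicate k gen_t_inv @ P_run es @ replicate m gen_t_inv | k m l es.
     length es = Suc l \<and> 0 < m \<and> k + m < l \<and> (0 < k \<longrightarrow> hd es \<noteq> 0)
     \<and> (if 3 \<le> l
        then P_admissible {[0,0,2], [1,0,2], [0,1,2], [0,0,3], [1,0,3], [-1,0,3], [0,1,3]} es
        else replicate k gen_t_inv @ P_run es @ replicate m gen_t_inv \<in> L4)}"

definition NF :: "letter list set" where
  "NF = NF1 \<union> NF2 \<union> NF3 \<union> NF4 \<union> NF5"

end

theory Submission
  imports Defs
begin

text \<open>Only finitely many normal forms have a run of at most three entries, so only the
  longer ones matter. Those built on an $N$-run $w$ are words $t^k w t^m$, and their conditions are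
  of two kinds.

  The shape of the word (a prefix of the run from a finite list, later entries in $\{0, 1, -1\}$, no
  two neighbouring nonzero entries outside the prefix, a nonzero last entry if $m > 0$) is checked by reading the word
  once with finite memory: these words form a regular language (\<open>regular_long_shapes\<close>). The
  condition $k + m \le l$, or $k + m < l$, says that the $t$-exponent of the word is at most 0, or
  at most $-1$, because the $N$-run contributes exactly $l$ letters $t^{-1}$ and no $t$. The words
  with such a bound on an exponent sum form a context-free language (\<open>context_free_surplus\<close>).
  The long normal forms are the intersection of the two (\<open>long_forms_eq\<close>), and the
  intersection of a context-free with a regular language is context-free
  (\<open>context_free_Int_regular\<close>).

  The families with positive $t$-exponent need no second argument: reading a word backwards and
  exchanging $t$ and $t^{-1}$ turns $P$-runs into $N$-runs, and it turns the long words of types $P$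
  and $NP_>$ into those of types $N$ and $NP_\le$ with $k < l$ in place of $k \le l$; in the same
  way types $PX$ and $NPX$ become types $X$, $XN$ and $XNP$ (\<open>reflect_long_forms\<close>).
  Context-free languages are closed under this operation.

  All facts about grammars come from one principle: the languages of the nonterminals are the least
  family of languages closed under the productions (\<open>Lang_closed\<close>, \<open>Lang_least\<close>). Regular
  languages are treated as the languages with finitely many left quotients, which yields both the
  closure properties and a deterministic automaton for the product construction.\<close>

section \<open>Context-free languages as least fixed points\<close>

definition conc :: "'t list set \<Rightarrow> 't list set \<Rightarrow> 't list set" (infixr "@@" 75) where
  "A @@ B = {u @ v | u v. u \<in> A \<and> v \<in> B}"

lemma concI: "u \<in> A \<Longrightarrow> v \<in> B \<Longrightarrow> u @ v \<in> A @@ B"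
  by (auto simp: conc_def)

lemma concE: "w \<in> A @@ B \<Longrightarrow> (\<And>u v. w = u @ v \<Longrightarrow> u \<in> A \<Longrightarrow> v \<in> B \<Longrightarrow> thesis) \<Longrightarrow> thesis"
  by (auto simp: conc_def)

lemma conc_mono: "A \<subseteq> A' \<Longrightarrow> B \<subseteq> B' \<Longrightarrow> A @@ B \<subseteq> A' @@ B'"
  by (auto simp: conc_def)

lemma conc_assoc: "(A @@ B) @@ C = A @@ B @@ C"
  by (auto simp: conc_def) (metis append_assoc)+

lemma conc_Nil [simp]: "{[]} @@ A = A" "A @@ {[]} = A"
  by (auto simp: conc_def)

primrec sym_words :: "('n \<Rightarrow> 't list set) \<Rightarrow> ('n, 't) sym \<Rightarrow> 't list set" where
  "sym_words I (Nt B) = I B"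
| "sym_words I (Tm x) = {[x]}"

text \<open>The words obtained from a sentential form by replacing every nonterminal \<open>B\<close> by a word of
  \<open>I B\<close>, independently for each occurrence.\<close>

primrec expand :: "('n \<Rightarrow> 't list set) \<Rightarrow> ('n, 't) sym list \<Rightarrow> 't list set" where
  "expand I [] = {[]}"
| "expand I (s # r) = sym_words I s @@ expand I r"

lemma expand_append: "expand I (r @ r') = expand I r @@ expand I r'"
  by (induction r) (auto simp: conc_assoc)

lemma expand_map_Tm [simp]: "expand I (map Tm w) = {w}"
  by (induction w) (auto simp: conc_def)

lemma sym_words_mono: "(\<And>B. I B \<subseteq> J B) \<Longrightarrow> sym_words I s \<subseteq> sym_words J s"
  by (cases s) auto

lemma expand_mono: "(\<And>B. I B \<subseteq> J B) \<Longrightarrow> expand I r \<subseteq> expand J r"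
  by (induction r) (simp_all add: conc_mono sym_words_mono)

text \<open>A family of languages closed under all productions keeps the terminal word inside the expansion of
  the sentential form at every step of a derivation, read backwards from the end. This replaces
  induction over derivations by a check of each production.\<close>

lemma Lang_least:
  assumes "\<And>B r. (B, r) \<in> P \<Longrightarrow> expand I r \<subseteq> I B"
  shows "Lang P S \<subseteq> I S"
proof
  fix w assume "w \<in> Lang P S"
  then have "([Nt S], map Tm w) \<in> (deriv_step P)\<^sup>*" by (simp add: Lang_def)
  then have "w \<in> expand I [Nt S]"
  proof (induction rule: converse_rtrancl_induct)
    case base
    show ?case by simp
  next
    case (step \<alpha> \<beta>)
    then obtain u v B r where "\<alpha> = u @ [Nt B] @ v" "\<beta> = u @ r @ v" "(B, r) \<in> P"
      by (auto simp: deriv_step_def)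
    moreover have "expand I u @@ expand I r @@ expand I v \<subseteq> expand I u @@ I B @@ expand I v"
      using assms[OF \<open>(B, r) \<in> P\<close>] by (intro conc_mono order_refl)
    ultimately show ?case using step.IH by (auto simp: expand_append)
  qed
  then show "w \<in> I S" by simp
qed

lemma derivs_context:
  assumes "(\<alpha>, \<beta>) \<in> (deriv_step P)\<^sup>*"
  shows "(u @ \<alpha> @ v, u @ \<beta> @ v) \<in> (deriv_step P)\<^sup>*"
  using assms
proof (induction rule: rtrancl_induct)
  case base
  show ?case by simp
next
  case (step \<beta> \<gamma>)
  from step.hyps(2) obtain u' v' B r
    where "\<beta> = u' @ [Nt B] @ v'" "\<gamma> = u' @ r @ v'" "(B, r) \<in> P"
    by (auto simp: deriv_step_def)
  then have "u @ \<beta> @ v = (u @ u') @ [Nt B] @ (v' @ v)" "u @ \<gamma> @ v = (u @ u') @ r @ (v' @ v)"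
    by auto
  then have "(u @ \<beta> @ v, u @ \<gamma> @ v) \<in> deriv_step P"
    using \<open>(B, r) \<in> P\<close> unfolding deriv_step_def by blast
  with step.IH show ?case by (rule rtrancl_into_rtrancl)
qed

lemma expand_Lang_derivs:
  "w \<in> expand (Lang P) r \<Longrightarrow> (r, map Tm w) \<in> (deriv_step P)\<^sup>*"
proof (induction r arbitrary: w)
  case Nil
  then show ?case by simp
next
  case (Cons s r)
  from Cons.prems obtain u v where w: "w = u @ v" "u \<in> sym_words (Lang P) s"
    "v \<in> expand (Lang P) r" by (auto elim: concE)
  have "([s], map Tm u) \<in> (deriv_step P)\<^sup>*"
    using w(2) by (cases s) (auto simp: Lang_def)
  from derivs_context[OF this, of "[]" r]
  have "(s # r, map Tm u @ r) \<in> (deriv_step P)\<^sup>*" by simp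
  also have "(map Tm u @ r, map Tm u @ map Tm v) \<in> (deriv_step P)\<^sup>*"
    using derivs_context[OF Cons.IH[OF w(3)], of "map Tm u" "[]"] by simp
  finally show ?case by (simp add: w(1))
qed

lemma Lang_closed:
  assumes "(B, r) \<in> P"
  shows "expand (Lang P) r \<subseteq> Lang P B"
proof
  fix w assume "w \<in> expand (Lang P) r"
  then have "(r, map Tm w) \<in> (deriv_step P)\<^sup>*" by (rule expand_Lang_derivs)
  moreover have "([Nt B], r) \<in> deriv_step P"
    using assms unfolding deriv_step_def by (intro CollectI exI[of _ "[]"] exI[of _ B] exI[of _ r]) auto
  ultimately show "w \<in> Lang P B"
    unfolding Lang_def by (auto intro: converse_rtrancl_into_rtrancl)
qed

lemma Lang_unfold: "Lang P B = (\<Union>r \<in> {r. (B, r) \<in> P}. expand (Lang P) r)"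
proof
  let ?I = "\<lambda>B. \<Union>r \<in> {r. (B, r) \<in> P}. expand (Lang P) r"
  have "?I B \<subseteq> Lang P B" for B using Lang_closed by fastforce
  then have "expand ?I r \<subseteq> expand (Lang P) r" for r by (rule expand_mono)
  then show "Lang P B \<subseteq> ?I B" by (intro Lang_least[of P ?I]) blast
  show "?I B \<subseteq> Lang P B" using Lang_closed by fastforce
qed

primrec rename_sym :: "('n \<Rightarrow> 'm) \<Rightarrow> ('n, 't) sym \<Rightarrow> ('m, 't) sym" where
  "rename_sym f (Nt B) = Nt (f B)"
| "rename_sym f (Tm x) = Tm x"

definition rename_prods :: "('n \<Rightarrow> 'm) \<Rightarrow> ('n, 't) prods \<Rightarrow> ('m, 't) prods" where
  "rename_prods f P = (\<lambda>(B, r). (f B, map (rename_sym f) r)) ` P"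

lemma finite_rename_prods: "finite P \<Longrightarrow> finite (rename_prods f P)"
  by (simp add: rename_prods_def)

lemma expand_rename:
  assumes "\<And>B. Nt B \<in> set r \<Longrightarrow> I (f B) = J B"
  shows "expand I (map (rename_sym f) r) = expand J r"
  using assms
proof (induction r)
  case (Cons s r)
  then show ?case by (cases s) auto
qed simp

text \<open>Renaming nonterminals injectively preserves languages, even inside a larger grammar \<open>Q\<close>, provided
  that \<open>Q\<close> adds no production for a renamed nonterminal. Injectivity is only demanded on a set
  \<open>N\<close> of nonterminals that contains those of \<open>P\<close>: this allows numbering the finitely many
  nonterminals in use even if their type is uncountable.\<close>

lemma Lang_rename:
  assumes inj: "inj_on f N" and S: "S \<in> N"
    and N: "\<And>B r. (B, r) \<in> P \<Longrightarrow> B \<in> N \<and> (\<forall>C. Nt C \<in> set r \<longrightarrow> C \<in> N)"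
    and sub: "rename_prods f P \<subseteq> Q"
    and fresh: "\<And>C r. (C, r) \<in> Q \<Longrightarrow> C \<in> f ` N \<Longrightarrow> (C, r) \<in> rename_prods f P"
  shows "Lang Q (f S) = Lang P S"
proof
  \<comment> \<open>Interpreting the nonterminals outside \<open>f ` N\<close> by all words makes every production for
    them sound.\<close>
  let ?I = "\<lambda>C. if C \<in> f ` N then Lang P (inv_into N f C) else UNIV"
  have "expand ?I r \<subseteq> ?I C" if "(C, r) \<in> Q" for C r
  proof (cases "C \<in> f ` N")
    case True
    with fresh that have "(C, r) \<in> rename_prods f P" by blast
    then obtain B r' where B: "(B, r') \<in> P" "C = f B" "r = map (rename_sym f) r'"
      by (auto simp: rename_prods_def)
    have "expand ?I r = expand (Lang P) r'"
      unfolding B(3) using N[OF B(1)] inj by (intro expand_rename) auto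
    then show ?thesis using Lang_closed[OF B(1)] N[OF B(1)] inj B(2) by auto
  qed auto
  then have "Lang Q (f S) \<subseteq> ?I (f S)" by (rule Lang_least)
  then show "Lang Q (f S) \<subseteq> Lang P S" using S inj by auto
  show "Lang P S \<subseteq> Lang Q (f S)"
  proof (rule Lang_least[of P "\<lambda>B. Lang Q (f B)"])
    fix B r assume "(B, r) \<in> P"
    then have "(f B, map (rename_sym f) r) \<in> Q" using sub by (force simp: rename_prods_def)
    from Lang_closed[OF this] show "expand (\<lambda>B. Lang Q (f B)) r \<subseteq> Lang Q (f B)"
      by (subst (asm) expand_rename) auto
  qed
qed

lemma context_free_Lang:
  assumes "finite P"
  shows "context_free (Lang P S)"
proof -
  define N where "N = insert S (\<Union>(B, r) \<in> P. insert B {C. Nt C \<in> set r})"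
  have "finite {C. Nt C \<in> set r}" for r :: "('a, 'b) sym list"
    using finite_vimageI[of "set r" Nt] by (simp add: vimage_def inj_def)
  then have "finite N" using assms by (auto simp: N_def)
  then obtain f :: "'a \<Rightarrow> nat" where "inj_on f N"
    using finite_imp_inj_to_nat_seg by blast
  then have "Lang (rename_prods f P) (f S) = Lang P S"
    by (rule Lang_rename) (auto simp: N_def)
  then show ?thesis
    unfolding context_free_def using finite_rename_prods[OF assms] by metis
qed

section \<open>Closure properties of context-free languages\<close>

lemma context_free_finite:
  assumes "finite L"
  shows "context_free L"
proof -
  let ?P = "(\<lambda>w. (0::nat, map Tm w)) ` L"
  have "Lang ?P 0 = (\<Union>r \<in> {r. (0, r) \<in> ?P}. expand (Lang ?P) r)" by (rule Lang_unfold)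
  also have "\<dots> = L" by force
  finally show ?thesis using context_free_Lang[of ?P 0] assms by simp
qed

text \<open>Two grammars placed side by side on disjoint nonterminals, with a fresh start symbol \<open>None\<close> whose
  right-hand sides \<open>R\<close> may use the nonterminals of both. Choosing \<open>R\<close> gives union and
  concatenation.\<close>

definition join_prods ::
  "(nat, 't) prods \<Rightarrow> (nat, 't) prods \<Rightarrow> (nat + nat, 't) sym list set \<Rightarrow> ((nat + nat) option, 't) prods"
  where "join_prods P Q R = rename_prods (\<lambda>A. Some (Inl A)) P \<union> rename_prods (\<lambda>A. Some (Inr A)) Q
    \<union> (\<lambda>r. (None, map (rename_sym Some) r)) ` R"

lemma Lang_join_prods:
  fixes P Q :: "(nat, 't) prods"
  shows
  "Lang (join_prods P Q R) None = (\<Union>r\<in>R. expand (case_sum (Lang P) (Lang Q)) r)"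
proof -
  have "Lang (join_prods P Q R) (Some (Inl S)) = Lang P S" for S
    by (rule Lang_rename[of "\<lambda>A. Some (Inl A)" UNIV])
      (auto simp: join_prods_def rename_prods_def inj_on_def)
  moreover have "Lang (join_prods P Q R) (Some (Inr S)) = Lang Q S" for S
    by (rule Lang_rename[of "\<lambda>A. Some (Inr A)" UNIV])
      (auto simp: join_prods_def rename_prods_def inj_on_def)
  ultimately have "Lang (join_prods P Q R) (Some C) = case_sum (Lang P) (Lang Q) C" for C
    by (cases C) auto
  then have "expand (Lang (join_prods P Q R)) (map (rename_sym Some) r)
      = expand (case_sum (Lang P) (Lang Q)) r" for r
    by (intro expand_rename)
  moreover have "{r. (None, r) \<in> join_prods P Q R} = map (rename_sym Some) ` R"
    by (auto simp: join_prods_def rename_prods_def)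
  ultimately show ?thesis by (subst Lang_unfold) simp
qed

lemma context_free_join:
  fixes P Q :: "(nat, 't) prods"
  assumes "finite P" "finite Q" "finite R"
  shows "context_free (\<Union>r\<in>R. expand (case_sum (Lang P) (Lang Q)) r)"
proof -
  have "finite (join_prods P Q R)"
    using assms by (simp add: join_prods_def finite_rename_prods)
  from context_free_Lang[OF this, of None] show ?thesis by (simp add: Lang_join_prods)
qed

lemma context_free_Un:
  fixes L M :: "'t list set"
  assumes "context_free L" "context_free M"
  shows "context_free (L \<union> M)"
proof -
  obtain P Q :: "(nat, 't) prods" and S T where "finite P" "L = Lang P S" "finite Q" "M = Lang Q T"
    using assms unfolding context_free_def by blast
  then show ?thesis using context_free_join[of P Q "{[Nt (Inl S)], [Nt (Inr T)]}"] by simp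
qed

lemma context_free_conc:
  fixes L M :: "'t list set"
  assumes "context_free L" "context_free M"
  shows "context_free (L @@ M)"
proof -
  obtain P Q :: "(nat, 't) prods" and S T where "finite P" "L = Lang P S" "finite Q" "M = Lang Q T"
    using assms unfolding context_free_def by blast
  then show ?thesis using context_free_join[of P Q "{[Nt (Inl S), Nt (Inr T)]}"] by simp
qed

lemma context_free_UN:
  assumes "finite X" "\<And>x. x \<in> X \<Longrightarrow> context_free (L x)"
  shows "context_free (\<Union>x\<in>X. L x)"
  using assms by (induction X rule: finite_induct) (auto simp: context_free_Un context_free_finite)

lemma expand_rev_map:
  "expand (\<lambda>B. (rev \<circ> map g) ` I B) (rev (map (map_sym id g) r)) = (rev \<circ> map g) ` expand I r"
proof (induction r)
  case (Cons s r)
  have s: "sym_words (\<lambda>B. (rev \<circ> map g) ` I B) (map_sym id g s) = (rev \<circ> map g) ` sym_words I s"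
    by (cases s) auto
  have "(rev \<circ> map g) ` expand I r @@ (rev \<circ> map g) ` sym_words I s
      = (rev \<circ> map g) ` (sym_words I s @@ expand I r)"
    by (fastforce simp: conc_def image_iff)
  then show ?case
    by (simp only: list.map rev.simps expand_append expand.simps s Cons.IH conc_Nil)
qed simp

text \<open>Reversing every right-hand side and applying \<open>g\<close> to its terminals gives a grammar for the image.\<close>

lemma context_free_rev_map:
  fixes L :: "'t list set" and g :: "'t \<Rightarrow> 's"
  assumes "context_free L"
  shows "context_free ((rev \<circ> map g) ` L)"
proof -
  obtain P :: "(nat, 't) prods" and S where P: "finite P" "L = Lang P S"
    using assms unfolding context_free_def by blast
  define Q where "Q = (\<lambda>(B, r). (B, rev (map (map_sym id g) r))) ` P"
  let ?J = "\<lambda>B. (rev \<circ> map g) -` Lang Q B"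
  have "Lang Q S \<subseteq> (rev \<circ> map g) ` Lang P S"
  proof (rule Lang_least[of Q "\<lambda>B. (rev \<circ> map g) ` Lang P B"])
    fix B r assume "(B, r) \<in> Q"
    then obtain r' where r': "(B, r') \<in> P" "r = rev (map (map_sym id g) r')"
      by (auto simp: Q_def)
    show "expand (\<lambda>B. (rev \<circ> map g) ` Lang P B) r \<subseteq> (rev \<circ> map g) ` Lang P B"
      unfolding r'(2) expand_rev_map using Lang_closed[OF r'(1)] by (rule image_mono)
  qed
  moreover have "Lang P S \<subseteq> ?J S"
  proof (rule Lang_least[of P ?J])
    fix B r assume "(B, r) \<in> P"
    then have "(B, rev (map (map_sym id g) r)) \<in> Q" by (force simp: Q_def)
    then have cl: "expand (Lang Q) (rev (map (map_sym id g) r)) \<subseteq> Lang Q B" by (rule Lang_closed)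
    have "expand (\<lambda>B. (rev \<circ> map g) ` ?J B) (rev (map (map_sym id g) r))
      \<subseteq> expand (Lang Q) (rev (map (map_sym id g) r))"
      by (rule expand_mono) auto
    also note cl
    finally show "expand ?J r \<subseteq> ?J B" unfolding expand_rev_map by auto
  qed
  ultimately have "Lang Q S = (rev \<circ> map g) ` L" using P(2) by auto
  moreover have "finite Q" using P(1) by (simp add: Q_def)
  ultimately show ?thesis using context_free_Lang by metis
qed

section \<open>Regular languages\<close>

text \<open>The left quotient (Brzozowski derivative) of a language by a word.\<close>

definition deriv :: "'t list \<Rightarrow> 't list set \<Rightarrow> 't list set" where
  "deriv u L = {v. u @ v \<in> L}"

text \<open>By the Myhill-Nerode theorem, these are exactly the languages accepted by finite automata; the left
  quotients are the states of the minimal deterministic automaton.\<close>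

definition regular :: "'t list set \<Rightarrow> bool" where
  "regular L \<longleftrightarrow> finite (range (\<lambda>u. deriv u L))"

lemma deriv_append: "deriv (u @ v) L = deriv v (deriv u L)"
  by (auto simp: deriv_def)

lemma deriv_Nil [simp]: "deriv [] L = L"
  by (simp add: deriv_def)

lemma regularI:
  assumes "finite X" "\<And>u. deriv u L \<in> X"
  shows "regular L"
  unfolding regular_def using assms by (auto intro: finite_subset)

text \<open>Every left quotient of a finite language consists of suffixes of its words.\<close>

lemma regular_finite:
  assumes "finite L"
  shows "regular L"
proof (rule regularI)
  show "finite (Pow (\<Union>w\<in>L. (\<lambda>n. drop n w) ` {..length w}))" using assms by auto
  show "deriv u L \<in> Pow (\<Union>w\<in>L. (\<lambda>n. drop n w) ` {..length w})" for u
  proof (intro PowI subsetI)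
    fix v assume "v \<in> deriv u L"
    then show "v \<in> (\<Union>w\<in>L. (\<lambda>n. drop n w) ` {..length w})"
      by (intro UN_I[of "u @ v"] image_eqI[of _ _ "length u"]) (auto simp: deriv_def)
  qed
qed

lemma regular_single: "regular {w}"
  by (simp add: regular_finite)

lemma regular_Un:
  assumes "regular L" "regular M"
  shows "regular (L \<union> M)"
proof (rule regularI)
  show "finite ((\<lambda>(A, B). A \<union> B) ` (range (\<lambda>u. deriv u L) \<times> range (\<lambda>u. deriv u M)))"
    using assms by (auto simp: regular_def)
  have "deriv u (L \<union> M) = deriv u L \<union> deriv u M" for u by (auto simp: deriv_def)
  then show "deriv u (L \<union> M) \<in> (\<lambda>(A, B). A \<union> B) ` (range (\<lambda>u. deriv u L) \<times> range (\<lambda>u. deriv u M))" for u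
    by auto
qed

lemma regular_UN:
  assumes "finite X" "\<And>x. x \<in> X \<Longrightarrow> regular (L x)"
  shows "regular (\<Union>x\<in>X. L x)"
  using assms by (induction X rule: finite_induct) (auto simp: regular_Un regular_finite)

lemma regular_Diff:
  assumes "regular L" "regular M"
  shows "regular (L - M)"
proof (rule regularI)
  show "finite ((\<lambda>(A, B). A - B) ` (range (\<lambda>u. deriv u L) \<times> range (\<lambda>u. deriv u M)))"
    using assms by (auto simp: regular_def)
  have "deriv u (L - M) = deriv u L - deriv u M" for u by (auto simp: deriv_def)
  then show "deriv u (L - M) \<in> (\<lambda>(A, B). A - B) ` (range (\<lambda>u. deriv u L) \<times> range (\<lambda>u. deriv u M))" for u
    by auto
qed

text \<open>A prefix \<open>u\<close> of a word of \<open>L @@ M\<close> ends inside the factor from \<open>L\<close>, or reaches into the factor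
  from \<open>M\<close>. Hence a quotient is determined by one quotient of \<open>L\<close> and a set of quotients of
  \<open>M\<close>, which leaves finitely many possibilities.\<close>

lemma deriv_conc:
  "deriv u (L @@ M) = deriv u L @@ M \<union> \<Union>{deriv u2 M | u1 u2. u = u1 @ u2 \<and> u1 \<in> L}"
proof (intro equalityI subsetI)
  fix v assume "v \<in> deriv u (L @@ M)"
  then obtain x y where xy: "u @ v = x @ y" "x \<in> L" "y \<in> M"
    by (auto simp: deriv_def conc_def)
  then consider c where "u = x @ c" "y = c @ v" | c where "x = u @ c" "v = c @ y"
    by (auto simp: append_eq_append_conv2)
  then show "v \<in> deriv u L @@ M \<union> \<Union>{deriv u2 M | u1 u2. u = u1 @ u2 \<and> u1 \<in> L}"
  proof cases
    case 1
    then have "v \<in> deriv c M" using xy(3) by (simp add: deriv_def)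
    then show ?thesis using xy(2) 1(1) by blast
  next
    case 2
    then have "c \<in> deriv u L" using xy(2) by (simp add: deriv_def)
    then show ?thesis using 2(2) xy(3) by (simp add: concI)
  qed
next
  fix v assume "v \<in> deriv u L @@ M \<union> \<Union>{deriv u2 M | u1 u2. u = u1 @ u2 \<and> u1 \<in> L}"
  then consider x y where "v = x @ y" "u @ x \<in> L" "y \<in> M"
    | u1 u2 where "u = u1 @ u2" "u1 \<in> L" "u2 @ v \<in> M"
    by (auto simp: deriv_def conc_def)
  then show "v \<in> deriv u (L @@ M)"
  proof cases
    case 1
    then show ?thesis using concI[of "u @ x" L y M] by (simp add: deriv_def)
  next
    case 2
    then show ?thesis using concI[of u1 L "u2 @ v" M] by (simp add: deriv_def)
  qed
qed

lemma regular_conc: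
  assumes "regular L" "regular M"
  shows "regular (L @@ M)"
proof (rule regularI)
  let ?X = "(\<lambda>(D, \<D>). D @@ M \<union> \<Union>\<D>) ` (range (\<lambda>u. deriv u L) \<times> Pow (range (\<lambda>u. deriv u M)))"
  show "finite ?X" using assms by (auto simp: regular_def)
  show "deriv u (L @@ M) \<in> ?X" for u
    unfolding deriv_conc
    by (intro image_eqI[where x = "(deriv u L, {deriv u2 M | u1 u2. u = u1 @ u2 \<and> u1 \<in> L})"]) auto
qed

inductive_set star :: "'t list set \<Rightarrow> 't list set" for L where
  star_Nil: "[] \<in> star L"
| star_app: "u \<in> L \<Longrightarrow> v \<in> star L \<Longrightarrow> u @ v \<in> star L"

lemma star_append: "u \<in> star L \<Longrightarrow> v \<in> star L \<Longrightarrow> u @ v \<in> star L"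
  by (induction rule: star.induct) (auto intro: star.intros)

text \<open>A cut of a word in \<open>star L\<close> falls into one of its factors, possibly at an end of it.\<close>

lemma star_split:
  assumes "w \<in> star L" "w = u @ v" "v \<noteq> []"
  shows "\<exists>u1 u2 x y. u = u1 @ u2 \<and> v = x @ y \<and> u1 \<in> star L \<and> u2 @ x \<in> L \<and> y \<in> star L"
  using assms
proof (induction arbitrary: u rule: star.induct)
  case (star_app a b)
  from star_app.prems(1) consider c where "u = a @ c" "b = c @ v" | c where "a = u @ c" "v = c @ b"
    by (auto simp: append_eq_append_conv2)
  then show ?case
  proof cases
    case 1
    with star_app.IH[of c] star_app.prems(2) obtain u1 u2 x y where
      "c = u1 @ u2" "v = x @ y" "u1 \<in> star L" "u2 @ x \<in> L" "y \<in> star L" by blast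
    then show ?thesis using 1 star_app.hyps(1)
      by (intro exI[of _ "a @ u1"] exI[of _ u2] exI[of _ x] exI[of _ y]) (auto intro: star.star_app)
  next
    case 2
    then show ?thesis using star_app.hyps
      by (intro exI[of _ "[]"] exI[of _ u] exI[of _ c] exI[of _ b]) (auto intro: star_Nil)
  qed
qed simp

lemma regular_star:
  assumes "regular L"
  shows "regular (star L)"
proof (rule regularI)
  let ?X = "(\<lambda>(E, \<D>). E \<union> \<Union>\<D> @@ star L) ` (Pow {[]} \<times> Pow (range (\<lambda>u. deriv u L)))"
  show "finite ?X" using assms by (auto simp: regular_def)
  show "deriv u (star L) \<in> ?X" for u
  proof -
    \<comment> \<open>By \<open>star_split\<close>, a nonempty continuation of \<open>u\<close> completes the factor that is open at the
      end of \<open>u\<close> and goes on with further factors; the empty one is treated apart.\<close>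
    let ?D = "{deriv u2 L | u1 u2. u = u1 @ u2 \<and> u1 \<in> star L}"
    have "deriv u (star L) = deriv u (star L) \<inter> {[]} \<union> \<Union>?D @@ star L"
    proof (intro equalityI subsetI)
      fix v assume v: "v \<in> deriv u (star L)"
      show "v \<in> deriv u (star L) \<inter> {[]} \<union> \<Union>?D @@ star L"
      proof (cases "v = []")
        case False
        with v star_split[of "u @ v" L u v] obtain u1 u2 x y where
          "u = u1 @ u2" "v = x @ y" "u1 \<in> star L" "u2 @ x \<in> L" "y \<in> star L"
          by (auto simp: deriv_def)
        then have "x \<in> \<Union>?D" by (auto simp: deriv_def)
        then show ?thesis using \<open>v = x @ y\<close> \<open>y \<in> star L\<close> by (auto intro: concI)
      qed (use v in auto)
    next
      fix v assume "v \<in> deriv u (star L) \<inter> {[]} \<union> \<Union>?D @@ star L"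
      then show "v \<in> deriv u (star L)"
      proof
        assume "v \<in> \<Union>?D @@ star L"
        then obtain x y u1 u2 where "v = x @ y" "u = u1 @ u2" "u1 \<in> star L" "u2 @ x \<in> L" "y \<in> star L"
          by (auto simp: deriv_def elim!: concE)
        then have "u1 @ (u2 @ x) @ y \<in> star L" by (intro star_append star_app)
        then show ?thesis by (simp add: deriv_def \<open>v = x @ y\<close> \<open>u = u1 @ u2\<close>)
      qed auto
    qed
    then show ?thesis
      by (intro image_eqI[where x = "(deriv u (star L) \<inter> {[]}, ?D)"]) auto
  qed
qed

section \<open>Intersection of a context-free and a regular language\<close>

text \<open>The triple construction. The states of the automaton are left quotients, and a nonterminal
  \<open>(D, A, D')\<close> of the product grammar generates the words of \<open>A\<close> that lead from state \<open>D\<close> to state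
  \<open>D'\<close>. A right-hand side is annotated with states so that the automaton passes through it
  consistently.\<close>

primrec forget_states :: "('q \<times> 'n \<times> 'q, 't) sym \<Rightarrow> ('n, 't) sym" where
  "forget_states (Nt X) = Nt (fst (snd X))"
| "forget_states (Tm x) = Tm x"

fun passes :: "'t list set \<Rightarrow> ('t list set \<times> 'n \<times> 't list set, 't) sym list \<Rightarrow> 't list set \<Rightarrow> bool" where
  "passes D [] D' \<longleftrightarrow> D' = D"
| "passes D (Nt (D1, A, D2) # r) D' \<longleftrightarrow> D1 = D \<and> passes D2 r D'"
| "passes D (Tm x # r) D' \<longleftrightarrow> passes (deriv [x] D) r D'"

definition Nts_in :: "'q set \<Rightarrow> ('q \<times> 'n \<times> 'q, 't) sym list \<Rightarrow> bool" where
  "Nts_in Q r \<longleftrightarrow> (\<forall>D A D'. Nt (D, A, D') \<in> set r \<longrightarrow> D \<in> Q \<and> D' \<in> Q)"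

definition product_prods ::
  "(nat, 't) prods \<Rightarrow> 't list set set \<Rightarrow> ('t list set \<times> nat \<times> 't list set, 't) prods" where
  "product_prods P Q = {((D, A, D'), r) | D A D' r. D \<in> Q \<and> D' \<in> Q
     \<and> (A, map forget_states r) \<in> P \<and> Nts_in Q r \<and> passes D r D'}"

lemma finite_product_prods:
  assumes "finite P" "finite Q"
  shows "finite (product_prods P Q)"
proof -
  let ?syms = "\<lambda>r. Tm ` {x. Tm x \<in> set r} \<union> Nt ` (Q \<times> {A. Nt A \<in> set r} \<times> Q)"
  have fin: "finite {A. Nt A \<in> set r}" "finite {x. Tm x \<in> set r}" for r :: "(nat, 'a) sym list"
    using finite_vimageI[of "set r" Nt] finite_vimageI[of "set r" Tm]
    by (simp_all add: vimage_def inj_def)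
  have "finite (\<Union>(A, r)\<in>P. (Q \<times> {A} \<times> Q) \<times> {r'. set r' \<subseteq> ?syms r \<and> length r' = length r})"
    using assms fin by (auto intro!: finite_lists_length_eq)
  moreover have "product_prods P Q \<subseteq>
    (\<Union>(A, r)\<in>P. (Q \<times> {A} \<times> Q) \<times> {r'. set r' \<subseteq> ?syms r \<and> length r' = length r})"
  proof
    fix p assume "p \<in> product_prods P Q"
    then obtain D A D' r where p: "p = ((D, A, D'), r)" "D \<in> Q" "D' \<in> Q"
      "(A, map forget_states r) \<in> P" "Nts_in Q r" by (auto simp: product_prods_def)
    have "s \<in> ?syms (map forget_states r)" if "s \<in> set r" for s
      using p(5) that by (cases s) (force simp: Nts_in_def image_iff)+
    then show "p \<in> (\<Union>(A, r)\<in>P. (Q \<times> {A} \<times> Q) \<times> {r'. set r' \<subseteq> ?syms r \<and> length r' = length r})"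
      using p(1-4) by (intro UN_I[OF p(4)]) auto
  qed
  ultimately show ?thesis by (rule finite_subset[rotated])
qed

lemma passes_expand:
  assumes "passes D r D'" "w \<in> expand (\<lambda>(D, A, D'). {w \<in> L A. deriv w D = D'}) r"
  shows "w \<in> expand L (map forget_states r) \<and> deriv w D = D'"
  using assms
proof (induction D r D' arbitrary: w rule: passes.induct)
  case (2 D D1 A D2 r D')
  then obtain u v where "w = u @ v" "u \<in> L A" "deriv u D = D2"
    "v \<in> expand (\<lambda>(D, A, D'). {w \<in> L A. deriv w D = D'}) r" by (auto elim!: concE)
  with 2 show ?case by (auto simp: deriv_append intro: concI)
next
  case (3 D x r D')
  then obtain v where "w = [x] @ v" "v \<in> expand (\<lambda>(D, A, D'). {w \<in> L A. deriv w D = D'}) r"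
    by (auto elim!: concE)
  with 3 show ?case by (auto simp: deriv_append[of "[x]" v, simplified] intro: concI[of "[x]", simplified])
qed auto

text \<open>The run of the automaton on a word determines the annotation, from left to right.\<close>

lemma expand_annotate:
  assumes "w \<in> expand (\<lambda>A. {w. \<forall>D\<in>Q. w \<in> L (D, A, deriv w D)}) r"
    and "D \<in> Q" and Q: "\<And>D w. D \<in> Q \<Longrightarrow> deriv w D \<in> Q"
  shows "\<exists>r'. map forget_states r' = r \<and> Nts_in Q r' \<and> passes D r' (deriv w D) \<and> w \<in> expand L r'"
  using assms(1,2)
proof (induction r arbitrary: w D)
  case Nil
  then show ?case by (auto simp: Nts_in_def)
next
  case (Cons s r)
  then obtain u v where w: "w = u @ v"
    "u \<in> sym_words (\<lambda>A. {w. \<forall>D\<in>Q. w \<in> L (D, A, deriv w D)}) s"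
    "v \<in> expand (\<lambda>A. {w. \<forall>D\<in>Q. w \<in> L (D, A, deriv w D)}) r" by (auto elim!: concE)
  from Cons.IH[OF w(3) Q[OF Cons.prems(2)], of u] obtain r' where r': "map forget_states r' = r"
    "Nts_in Q r'" "passes (deriv u D) r' (deriv w D)" "v \<in> expand L r'"
    by (auto simp: w(1) deriv_append)
  show ?case
  proof (cases s)
    case (Nt A)
    then show ?thesis using w r' Cons.prems(2) Q
      by (intro exI[of _ "Nt (D, A, deriv u D) # r'"]) (auto simp: Nts_in_def intro: concI)
  next
    case (Tm x)
    then show ?thesis using w r'
      by (intro exI[of _ "Tm x # r'"]) (auto simp: Nts_in_def intro: concI[of "[x]", simplified])
  qed
qed

text \<open>Both inclusions follow from \<open>Lang_least\<close>: once for the product grammar, with the claimed languages as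
  interpretation, and once for \<open>P\<close>, interpreting \<open>A\<close> by the words which the product grammar
  generates from \<open>(D, A, deriv w D)\<close> for every state \<open>D\<close>.\<close>

lemma Lang_product_prods:
  assumes Q: "\<And>D w. D \<in> Q \<Longrightarrow> deriv w D \<in> Q" and "D \<in> Q"
  shows "Lang (product_prods P Q) (D, S, D') = {w \<in> Lang P S. deriv w D = D'}"
proof
  let ?I = "\<lambda>(D, A, D'). {w \<in> Lang P A. deriv w D = D'}"
  have "Lang (product_prods P Q) (D, S, D') \<subseteq> ?I (D, S, D')"
  proof (rule Lang_least[of "product_prods P Q" ?I])
    fix X r assume "(X, r) \<in> product_prods P Q"
    then obtain D A D' where X: "X = (D, A, D')" "(A, map forget_states r) \<in> P" "passes D r D'"
      by (auto simp: product_prods_def)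
    show "expand ?I r \<subseteq> ?I X"
    proof
      fix w assume "w \<in> expand ?I r"
      from passes_expand[OF X(3) this] Lang_closed[OF X(2)] show "w \<in> ?I X" by (auto simp: X(1))
    qed
  qed
  then show "Lang (product_prods P Q) (D, S, D') \<subseteq> {w \<in> Lang P S. deriv w D = D'}" by simp
next
  let ?J = "\<lambda>A. {w. \<forall>D\<in>Q. w \<in> Lang (product_prods P Q) (D, A, deriv w D)}"
  have "Lang P S \<subseteq> ?J S"
  proof (rule Lang_least[of P ?J])
    fix A r assume A: "(A, r) \<in> P"
    show "expand ?J r \<subseteq> ?J A"
    proof (intro subsetI CollectI ballI)
      fix w D assume "w \<in> expand ?J r" "D \<in> Q"
      from expand_annotate[OF this Q] obtain r' where r': "map forget_states r' = r" "Nts_in Q r'"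
        "passes D r' (deriv w D)" "w \<in> expand (Lang (product_prods P Q)) r'" by auto
      then have "((D, A, deriv w D), r') \<in> product_prods P Q"
        using A Q[OF \<open>D \<in> Q\<close>] \<open>D \<in> Q\<close> by (simp add: product_prods_def)
      from subsetD[OF Lang_closed[OF this] r'(4)]
      show "w \<in> Lang (product_prods P Q) (D, A, deriv w D)" .
    qed
  qed
  then show "{w \<in> Lang P S. deriv w D = D'} \<subseteq> Lang (product_prods P Q) (D, S, D')"
    using \<open>D \<in> Q\<close> by auto
qed

lemma context_free_Int_regular:
  fixes L R :: "'t list set"
  assumes "context_free L" "regular R"
  shows "context_free (L \<inter> R)"
proof -
  obtain P :: "(nat, 't) prods" and S where P: "finite P" "L = Lang P S"
    using assms(1) unfolding context_free_def by blast
  define Q where "Q = range (\<lambda>u. deriv u R)"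
  have fin: "finite Q" using assms(2) by (simp add: Q_def regular_def)
  have "R \<in> Q" by (auto simp: Q_def intro: range_eqI[of _ _ "[]"])
  have Q: "deriv w D \<in> Q" if "D \<in> Q" for D w
    using that by (auto simp: Q_def deriv_append[symmetric])
  have "L \<inter> R = (\<Union>D \<in> {D \<in> Q. [] \<in> D}. Lang (product_prods P Q) (R, S, D))"
    using Q[OF \<open>R \<in> Q\<close>] by (auto simp: Lang_product_prods[OF Q \<open>R \<in> Q\<close>] P(2)) (auto simp: deriv_def)
  then show ?thesis
    using fin by (auto intro!: context_free_UN context_free_Lang finite_product_prods P(1))
qed

section \<open>Words with a surplus of one letter\<close>

definition surplus :: "'t \<Rightarrow> 't \<Rightarrow> nat \<Rightarrow> 't list set" where
  "surplus x y c = {w. count_list w x + c \<le> count_list w y}"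

text \<open>Reading from left to right, the number of \<open>y\<close> minus the number of \<open>x\<close> changes by at most 1 per
  letter, so it must become positive for the first time by a letter \<open>y\<close> read at balance 0.\<close>

lemma first_excess:
  assumes "count_list w x < count_list w y"
  shows "\<exists>u v. w = u @ y # v \<and> count_list u x = count_list u y"
  using assms
proof (induction w rule: rev_induct)
  case (snoc s w)
  show ?case
  proof (cases "count_list w x < count_list w y")
    case True
    with snoc.IH show ?thesis by fastforce
  next
    case False
    with snoc.prems have "s = y" "count_list w x = count_list w y" by (auto split: if_splits)
    then show ?thesis by blast
  qed
qed simp

lemma surplus_Suc:
  assumes "x \<noteq> y"
  shows "surplus x y (Suc c) = surplus x y 0 @@ {[y]} @@ surplus x y c"
proof (intro equalityI subsetI)
  fix w assume w: "w \<in> surplus x y (Suc c)"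
  then obtain u v where uv: "w = u @ y # v" "count_list u x = count_list u y"
    using first_excess[of w x y] by (auto simp: surplus_def)
  then have "u \<in> surplus x y 0" "v \<in> surplus x y c" using w assms by (auto simp: surplus_def)
  then have "u @ [y] @ v \<in> surplus x y 0 @@ {[y]} @@ surplus x y c" by (intro concI) auto
  then show "w \<in> surplus x y 0 @@ {[y]} @@ surplus x y c" by (simp add: uv(1))
qed (use assms in \<open>auto simp: surplus_def elim!: concE\<close>)

text \<open>The grammar has one nonterminal $G$ and the productions
  $G \to \epsilon$, $G \to s G$ for $s \ne x$, $G \to x G y G$ and $G \to y G x G$. It generates
  only words with at least as many \<open>y\<close> as \<open>x\<close>. Conversely, consider the first letter of such a
  word. If it is \<open>x\<close>, the rest has an excess of \<open>y\<close> and is split at the first excess. If it is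
  another letter, either the rest still is such a word, or the letter is \<open>y\<close> and the rest has one
  \<open>x\<close> too many, where it is split in the same way.\<close>

lemma context_free_surplus_0:
  fixes x y :: "'t::finite"
  assumes "x \<noteq> y"
  shows "context_free (surplus x y 0)"
proof -
  let ?G = "Nt (0::nat)"
  define P :: "(nat, 't) prods" where "P = insert (0, []) ((\<lambda>s. (0, [Tm s, ?G])) ` (- {x})
    \<union> {(0, [Tm x, ?G, Tm y, ?G]), (0, [Tm y, ?G, Tm x, ?G])})"
  have "Lang P 0 \<subseteq> surplus x y 0"
  proof (rule Lang_least[of P "\<lambda>_. surplus x y 0"])
    fix B r assume "(B, r) \<in> P"
    then show "expand (\<lambda>_. surplus x y 0) r \<subseteq> surplus x y 0"
      using assms by (auto simp: P_def surplus_def elim!: concE split: if_splits)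
  qed
  moreover have "w \<in> Lang P 0" if "w \<in> surplus x y 0" for w
    using that
  proof (induction w rule: length_induct)
    case (1 w)
    have G0: "[] \<in> Lang P 0" using Lang_closed[of 0 "[]" P] by (simp add: P_def)
    have G1: "s # v \<in> Lang P 0" if "s \<noteq> x" "v \<in> Lang P 0" for s v
      using Lang_closed[of 0 "[Tm s, ?G]" P] that concI[of "[s]" _ v] by (auto simp: P_def)
    have G2: "x # u @ y # v \<in> Lang P 0" if "u \<in> Lang P 0" "v \<in> Lang P 0" for u v
    proof -
      have "[x] @ u @ [y] @ v \<in> expand (Lang P) [Tm x, ?G, Tm y, ?G]"
        using that by (simp only: expand.simps sym_words.simps conc_Nil) (intro concI; simp)
      then show ?thesis using Lang_closed[of 0 "[Tm x, ?G, Tm y, ?G]" P] by (auto simp: P_def)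
    qed
    have G3: "y # u @ x # v \<in> Lang P 0" if "u \<in> Lang P 0" "v \<in> Lang P 0" for u v
    proof -
      have "[y] @ u @ [x] @ v \<in> expand (Lang P) [Tm y, ?G, Tm x, ?G]"
        using that by (simp only: expand.simps sym_words.simps conc_Nil) (intro concI; simp)
      then show ?thesis using Lang_closed[of 0 "[Tm y, ?G, Tm x, ?G]" P] by (auto simp: P_def)
    qed
    have IH: "v \<in> Lang P 0" if "length v < length w" "count_list v x \<le> count_list v y" for v
      using 1 that by (simp add: surplus_def)
    show ?case
    proof (cases w)
      case Nil
      then show ?thesis using G0 by simp
    next
      case (Cons s w')
      have le: "count_list w x \<le> count_list w y" using 1 by (simp add: surplus_def)
      consider "s = x" | "s \<noteq> x" "count_list w' x \<le> count_list w' y"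
        | "s = y" "count_list w' y < count_list w' x"
        using le Cons assms by (cases "s = y"; cases "s = x") force+
      then show ?thesis
      proof cases
        case 1
        then have "count_list w' x < count_list w' y" using le Cons assms by simp
        from first_excess[OF this] obtain u v where "w' = u @ y # v" "count_list u x = count_list u y"
          by blast
        then have "u \<in> Lang P 0" "v \<in> Lang P 0" using le Cons 1 assms by (auto intro!: IH)
        from G2[OF this] show ?thesis by (simp add: Cons 1 \<open>w' = u @ y # v\<close>)
      next
        case 2
        then have "w' \<in> Lang P 0" using Cons by (auto intro!: IH)
        from G1[OF 2(1) this] show ?thesis by (simp add: Cons)
      next
        case 3
        from first_excess[OF this(2)] obtain u v where
          "w' = u @ x # v" "count_list u x = count_list u y" by metis
        then have "u \<in> Lang P 0" "v \<in> Lang P 0" using le Cons 3 assms by (auto intro!: IH)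
        from G3[OF this] show ?thesis by (simp add: Cons 3(1) \<open>w' = u @ x # v\<close>)
      qed
    qed
  qed
  ultimately have "Lang P 0 = surplus x y 0" by auto
  moreover have "finite P" by (simp add: P_def)
  ultimately show ?thesis using context_free_Lang by metis
qed

lemma context_free_surplus:
  fixes x y :: "'t::finite"
  assumes "x \<noteq> y"
  shows "context_free (surplus x y c)"
proof (induction c)
  case (Suc c)
  then show ?case unfolding surplus_Suc[OF assms]
    by (intro context_free_conc context_free_surplus_0[OF assms] Suc.IH context_free_finite) simp
qed (rule context_free_surplus_0[OF assms])

section \<open>Runs with sparse entries\<close>

instance letter :: finite
proof
  have "UNIV = {gen_a, gen_a_inv, gen_t, gen_t_inv}" using letter.exhaust by auto
  then show "finite (UNIV :: letter set)" by (metis finite.intros)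
qed

text \<open>The part of an $N$-run contributed by entries that are not the first: each of them comes with the
  letter $t^{-1}$ before it. Unlike \<open>N_run\<close>, it turns concatenation of lists into concatenation of
  words.\<close>

definition blocks :: "int list \<Rightarrow> letter list" where
  "blocks es = concat (map (\<lambda>e. gen_t_inv # a_pow e) es)"

lemma blocks_simps [simp]:
  "blocks [] = []" "blocks (e # es) = gen_t_inv # a_pow e @ blocks es"
  by (simp_all add: blocks_def)

lemma blocks_append: "blocks (es @ es') = blocks es @ blocks es'"
  by (simp add: blocks_def)

lemma N_run_Cons: "N_run (e # es) = a_pow e @ blocks es"
  by (induction es arbitrary: e) auto

lemma N_run_append: "es \<noteq> [] \<Longrightarrow> N_run (es @ es') = N_run es @ blocks es'"
  by (cases es) (simp_all add: N_run_Cons blocks_append)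

lemma count_a_pow [simp]: "x = gen_t \<or> x = gen_t_inv \<Longrightarrow> count_list (a_pow e) x = 0"
  by (auto simp: a_pow_def count_list_0_iff)

lemma count_blocks [simp]:
  "count_list (blocks es) gen_t = 0" "count_list (blocks es) gen_t_inv = length es"
  by (induction es) auto

lemma count_N_run [simp]:
  "count_list (N_run es) gen_t = 0" "count_list (N_run es) gen_t_inv = length es - 1"
  by (cases es; simp add: N_run_Cons)+

lemma count_replicate [simp]: "count_list (replicate n x) y = (if x = y then n else 0)"
  by (induction n) auto

text \<open>The condition on the entries that follow an entry \<open>e\<close>.\<close>

definition sparse_after :: "int \<Rightarrow> int list \<Rightarrow> bool" where
  "sparse_after e es \<longleftrightarrow> set es \<subseteq> {0, 1, -1} \<and> successively (\<lambda>x y. x = 0 \<or> y = 0) (e # es)"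

lemma sparse_after_simps [simp]:
  "sparse_after e []"
  "sparse_after e (x # es) \<longleftrightarrow> x \<in> {0, 1, -1} \<and> (e = 0 \<or> x = 0) \<and> sparse_after x es"
  by (auto simp: sparse_after_def)

text \<open>A sparse list of entries factors uniquely into pieces that end in a zero, possibly followed by one
  last nonzero entry. These are the pieces.\<close>

definition zero_blocks :: "letter list set" where
  "zero_blocks = blocks ` {[0], [1, 0], [-1, 0]}"

definition nonzero_end :: "int list \<Rightarrow> bool" where
  "nonzero_end es \<longleftrightarrow> es \<noteq> [] \<and> last es \<noteq> 0"

definition final_entries :: "bool \<Rightarrow> int list set" where
  "final_entries b = {es \<in> {[], [1], [-1]}. b \<longrightarrow> es \<noteq> []}"

lemma blocks_sparse_split:
  "sparse_after 0 es \<Longrightarrow> b \<longrightarrow> nonzero_end es \<Longrightarrow> blocks es \<in> star zero_blocks @@ blocks ` final_entries b"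
proof (induction es rule: length_induct)
  case (1 es)
  have step: "blocks (f @ es') \<in> star zero_blocks @@ blocks ` final_entries b"
    if "es = f @ es'" "f \<in> {[0], [1, 0], [-1, 0]}" "sparse_after 0 es'" for f es'
  proof -
    have "b \<longrightarrow> nonzero_end es'" using 1(3) that(1,2) by (auto simp: nonzero_end_def split: if_splits)
    with 1(1) that have "blocks es' \<in> star zero_blocks @@ blocks ` final_entries b" by auto
    then obtain u v where "blocks es' = u @ v" "u \<in> star zero_blocks" "v \<in> blocks ` final_entries b"
      by (auto elim: concE)
    moreover have "blocks f \<in> zero_blocks" using that(2) unfolding zero_blocks_def by blast
    ultimately have "(blocks f @ u) @ v \<in> star zero_blocks @@ blocks ` final_entries b"
      by (intro concI star_app)
    then show ?thesis using \<open>blocks es' = u @ v\<close> by (simp add: blocks_append)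
  qed
  consider "es = []" | es' where "es = 0 # es'" | x where "es = [x]" "x \<noteq> 0"
    | x y es' where "es = x # y # es'" "x \<noteq> 0"
    by (cases es) (auto, metis neq_Nil_conv)
  then show ?case
  proof cases
    case 1
    then have "[] @ blocks [] \<in> star zero_blocks @@ blocks ` final_entries b"
      using "1.prems"(2) by (intro concI imageI star_Nil) (auto simp: final_entries_def nonzero_end_def)
    then show ?thesis using 1 by simp
  next
    case 2
    then show ?thesis using step[of "[0]" es'] "1.prems"(1) by simp
  next
    case 3
    then have "[] @ blocks [x] \<in> star zero_blocks @@ blocks ` final_entries b"
      using "1.prems"(1) by (intro concI imageI star_Nil) (auto simp: final_entries_def)
    then show ?thesis using 3 by simp
  next
    case 4
    then have "y = 0" "sparse_after 0 es'" "x \<in> {1, -1}" using "1.prems"(1) by auto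
    then show ?thesis using step[of "[x, 0]" es'] 4(1) by auto
  qed
qed

lemma star_zero_blocks:
  "w \<in> star zero_blocks \<Longrightarrow> \<exists>es'. blocks es' = w \<and> sparse_after 0 (es' @ es)"
  if "sparse_after 0 es"
proof (induction rule: star.induct)
  case star_Nil
  then show ?case using that by (intro exI[of _ "[]"]) simp
next
  case (star_app u v)
  then obtain f es' where "u = blocks f" "f \<in> {[0], [1, 0], [-1, 0]}" "blocks es' = v"
    "sparse_after 0 (es' @ es)" unfolding zero_blocks_def by blast
  then show ?case by (intro exI[of _ "f @ es'"]) (auto simp: blocks_append)
qed

definition sparse_tails :: "int \<Rightarrow> bool \<Rightarrow> letter list set" where
  "sparse_tails e b = {blocks es | es. sparse_after e es \<and> (b \<longrightarrow> nonzero_end es)}"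

text \<open>After a zero there is no constraint on the next entry, so the tails are exactly the products of
  pieces ending in a zero with an optional (or, if \<open>b\<close> holds, obligatory) last nonzero entry.\<close>

lemma sparse_tails_zero: "sparse_tails 0 b = star zero_blocks @@ blocks ` final_entries b"
proof (intro equalityI subsetI)
  fix w assume "w \<in> star zero_blocks @@ blocks ` final_entries b"
  then obtain u es where w: "w = u @ blocks es" "u \<in> star zero_blocks" "es \<in> final_entries b"
    by (auto elim!: concE)
  then have "sparse_after 0 es" by (auto simp: final_entries_def)
  from star_zero_blocks[OF this w(2)] obtain es' where "blocks es' = u" "sparse_after 0 (es' @ es)"
    by blast
  then show "w \<in> sparse_tails 0 b" using w(1,3) unfolding sparse_tails_def
    by (intro CollectI exI[of _ "es' @ es"]) (auto simp: blocks_append final_entries_def nonzero_end_def)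
qed (auto simp: sparse_tails_def blocks_sparse_split)

text \<open>After a nonzero entry comes a zero, and then the previous case applies.\<close>

lemma sparse_tails_nonzero:
  assumes "e \<noteq> 0"
  shows "sparse_tails e b = (if b then {} else {[]}) \<union> {blocks [0]} @@ sparse_tails 0 b"
proof (intro equalityI subsetI)
  fix w assume "w \<in> sparse_tails e b"
  then obtain es where es: "w = blocks es" "sparse_after e es" "b \<longrightarrow> nonzero_end es"
    by (auto simp: sparse_tails_def)
  show "w \<in> (if b then {} else {[]}) \<union> {blocks [0]} @@ sparse_tails 0 b"
  proof (cases es)
    case Nil
    then show ?thesis using es by (auto simp: nonzero_end_def)
  next
    case (Cons x es')
    then have "x = 0" "sparse_after 0 es'" "b \<longrightarrow> nonzero_end es'"
      using es assms by (auto simp: nonzero_end_def split: if_splits)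
    then have "blocks [0] @ blocks es' \<in> {blocks [0]} @@ sparse_tails 0 b"
      by (intro concI) (auto simp: sparse_tails_def)
    then show ?thesis using es(1) Cons \<open>x = 0\<close> by (simp add: a_pow_def)
  qed
next
  fix w assume w: "w \<in> (if b then {} else {[]}) \<union> {blocks [0]} @@ sparse_tails 0 b"
  consider "w = []" "\<not> b" | es where "w = blocks (0 # es)" "sparse_after 0 es" "b \<longrightarrow> nonzero_end es"
    using w by (auto simp: sparse_tails_def elim!: concE split: if_splits)
  then show "w \<in> sparse_tails e b"
  proof cases
    case 1
    then show ?thesis unfolding sparse_tails_def by (intro CollectI exI[of _ "[]"]) simp
  next
    case 2
    then show ?thesis unfolding sparse_tails_def
      by (intro CollectI exI[of _ "0 # es"]) (auto simp: nonzero_end_def)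
  qed
qed

lemma regular_sparse_tails: "regular (sparse_tails e b)"
proof -
  have zero: "regular (sparse_tails 0 b)"
    unfolding sparse_tails_zero zero_blocks_def final_entries_def
    by (intro regular_conc regular_star regular_finite) auto
  show ?thesis
  proof (cases "e = 0")
    case False
    show ?thesis unfolding sparse_tails_nonzero[OF False]
      by (intro regular_Un regular_conc regular_finite zero) auto
  qed (simp add: zero)
qed

lemma star_letter: "star {[x]} = range (\<lambda>n. replicate n x)"
proof (intro equalityI subsetI)
  fix w assume "w \<in> star {[x]}"
  then show "w \<in> range (\<lambda>n. replicate n x)"
    by (induction rule: star.induct) (auto intro: range_eqI[of _ _ 0] range_eqI[of _ _ "Suc n" for n])
next
  have "replicate n x \<in> star {[x]}" for n
    by (induction n) (auto intro: star.intros star_app[of "[x]", simplified])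
  then show "w \<in> star {[x]}" if "w \<in> range (\<lambda>n. replicate n x)" for w using that by auto
qed

section \<open>Long words of type \<open>N\<close> and \<open>X\<close>\<close>

text \<open>The last entry of the prefix is the only one of its entries that is constrained together with the
  entries behind the prefix.\<close>

lemma N_admissible_iff:
  assumes "4 \<le> length es"
  shows "N_admissible A es \<longleftrightarrow> take 3 es \<in> with_neg A \<and> sparse_after (last (take 3 es)) (drop 3 es)"
proof -
  have l: "last (take 3 es) = es ! 2" using assms by (subst last_conv_nth) auto
  have d: "last (take 3 es) # drop 3 es = drop 2 es"
    unfolding l using Cons_nth_drop_Suc[of 2 es] assms by (simp add: numeral_3_eq_3 numeral_2_eq_2)
  have "successively (\<lambda>x y. x = 0 \<or> y = 0) (last (take 3 es) # drop 3 es)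
    \<longleftrightarrow> (\<forall>j. Suc j < length es - 2 \<longrightarrow> es ! (2 + j) = 0 \<or> es ! Suc (2 + j) = 0)"
    using assms by (simp add: d successively_conv_nth)
  also have "\<dots> \<longleftrightarrow> (\<forall>i. 3 \<le> Suc i \<and> Suc i < length es \<longrightarrow> es ! i = 0 \<or> es ! Suc i = 0)"
  proof (intro iffI allI impI)
    fix i assume H: "\<forall>j. Suc j < length es - 2 \<longrightarrow> es ! (2 + j) = 0 \<or> es ! Suc (2 + j) = 0"
      and i: "3 \<le> Suc i \<and> Suc i < length es"
    then have "2 + (i - 2) = i" "Suc (i - 2) < length es - 2" by auto
    then show "es ! i = 0 \<or> es ! Suc i = 0" using H by metis
  next
    fix j assume "\<forall>i. 3 \<le> Suc i \<and> Suc i < length es \<longrightarrow> es ! i = 0 \<or> es ! Suc i = 0"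
      and "Suc j < length es - 2"
    then show "es ! (2 + j) = 0 \<or> es ! Suc (2 + j) = 0" by (auto dest: spec[of _ "2 + j"])
  qed
  finally have s: "successively (\<lambda>x y. x = 0 \<or> y = 0) (last (take 3 es) # drop 3 es)
    \<longleftrightarrow> (\<forall>i. 3 \<le> Suc i \<and> Suc i < length es \<longrightarrow> es ! i = 0 \<or> es ! Suc i = 0)" .
  have "set (drop 3 es) \<subseteq> {0, 1, -1} \<longleftrightarrow> (\<forall>j < length es - 3. es ! (3 + j) \<in> {0, 1, -1})"
    using assms by (simp add: subset_code(1) all_set_conv_all_nth)
  also have "\<dots> \<longleftrightarrow> (\<forall>i. 3 \<le> i \<and> i < length es \<longrightarrow> es ! i \<in> {0, 1, -1})"
  proof (intro iffI allI impI)
    fix i assume H: "\<forall>j < length es - 3. es ! (3 + j) \<in> {0, 1, -1}"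
      and i: "3 \<le> i \<and> i < length es"
    then have "3 + (i - 3) = i" "i - 3 < length es - 3" by auto
    then show "es ! i \<in> {0, 1, -1}" using H by metis
  qed auto
  finally show ?thesis unfolding N_admissible_def sparse_after_def s by blast
qed

text \<open>All conditions on the long normal forms except for the comparison of $k + m$ with $l$. The parameter
  \<open>K\<close> is $\{0\}$ for types $N$ and $NP_\le$, and the set of positive numbers for types $X$, $XN$
  and $XNP$.\<close>

definition long_shapes :: "nat set \<Rightarrow> int list set \<Rightarrow> letter list set" where
  "long_shapes K A = {replicate k gen_t @ N_run es @ replicate m gen_t | k m es.
     k \<in> K \<and> 4 \<le> length es \<and> N_admissible A es \<and> (0 < m \<longrightarrow> last es \<noteq> 0)}"

text \<open>A regular expression for these words. If no $t$ follows the run, its tail is any nonempty sparse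
  one; otherwise the last entry is nonzero, which also makes the tail nonempty.\<close>

lemma long_shapes_eq:
  assumes len: "\<forall>p\<in>A. length p = 3"
  shows "long_shapes K A = (\<Union>p \<in> with_neg A. (\<lambda>k. replicate k gen_t) ` K @@ {N_run p}
    @@ ((sparse_tails (last p) False - {[]}) \<union> sparse_tails (last p) True @@ {[gen_t]} @@ star {[gen_t]}))"
    (is "_ = (\<Union>p \<in> _. ?T @@ {N_run p} @@ ?E p)")
proof (intro equalityI subsetI)
  fix w assume "w \<in> long_shapes K A"
  then obtain k m es where w: "w = replicate k gen_t @ N_run es @ replicate m gen_t" "k \<in> K"
    "4 \<le> length es" "N_admissible A es" "0 < m \<longrightarrow> last es \<noteq> 0"
    by (auto simp: long_shapes_def)
  let ?p = "take 3 es" and ?q = "drop 3 es"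
  have p: "?p \<in> with_neg A" and q: "sparse_after (last ?p) ?q"
    using w(3,4) by (auto simp: N_admissible_iff)
  have run: "N_run es = N_run ?p @ blocks ?q"
    by (subst N_run_append[symmetric]) (use w(3) in auto)
  have "blocks ?q @ replicate m gen_t \<in> ?E ?p"
  proof (cases m)
    case 0
    have "blocks ?q \<noteq> []" using w(3) by (cases ?q) auto
    then show ?thesis using q 0 by (auto simp: sparse_tails_def)
  next
    case (Suc n)
    then have "blocks ?q \<in> sparse_tails (last ?p) True"
      using q w(3,5) by (auto simp: sparse_tails_def nonzero_end_def)
    then have "blocks ?q @ [gen_t] @ replicate n gen_t
        \<in> sparse_tails (last ?p) True @@ {[gen_t]} @@ star {[gen_t]}"
      by (intro concI) (auto simp: star_letter)
    then show ?thesis using Suc by simp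
  qed
  then have "replicate k gen_t @ N_run ?p @ blocks ?q @ replicate m gen_t \<in> ?T @@ {N_run ?p} @@ ?E ?p"
    using w(2) by (intro concI) auto
  then show "w \<in> (\<Union>p \<in> with_neg A. ?T @@ {N_run p} @@ ?E p)"
    using p unfolding w(1) run by (intro UN_I[OF p]) simp
next
  fix w assume "w \<in> (\<Union>p \<in> with_neg A. ?T @@ {N_run p} @@ ?E p)"
  then obtain p where "p \<in> with_neg A" "w \<in> ?T @@ {N_run p} @@ ?E p" by blast
  moreover from this(2) obtain k v where "k \<in> K" "w = replicate k gen_t @ N_run p @ v" "v \<in> ?E p"
    by (blast elim: concE)
  ultimately have w: "p \<in> with_neg A" "k \<in> K" "w = replicate k gen_t @ N_run p @ v" "v \<in> ?E p"
    by simp_all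
  have p: "length p = 3" using w(1) len by (auto simp: with_neg_def)
  obtain q m where q: "v = blocks q @ replicate m gen_t" "sparse_after (last p) q" "q \<noteq> []"
    "0 < m \<longrightarrow> last q \<noteq> 0"
  proof (cases "v \<in> sparse_tails (last p) False - {[]}")
    case True
    then obtain q where "v = blocks q" "sparse_after (last p) q" "v \<noteq> []"
      by (auto simp: sparse_tails_def)
    moreover from this have "q \<noteq> []" by auto
    ultimately show ?thesis using that[of q 0] by simp
  next
    case False
    then have "v \<in> sparse_tails (last p) True @@ {[gen_t]} @@ star {[gen_t]}" using w(4) by blast
    then obtain q n where "v = blocks q @ [gen_t] @ replicate n gen_t" "sparse_after (last p) q"
      "nonzero_end q" by (auto simp: sparse_tails_def star_letter elim!: concE)
    then show ?thesis using that[of q "Suc n"] by (auto simp: nonzero_end_def)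
  qed
  have "4 \<le> length (p @ q)" using p q(3) by (cases q) auto
  moreover from this have "N_admissible A (p @ q)" using w(1) p q(2) by (simp add: N_admissible_iff)
  moreover have "w = replicate k gen_t @ N_run (p @ q) @ replicate m gen_t"
    using p by (subst N_run_append) (auto simp: w(3) q(1))
  ultimately show "w \<in> long_shapes K A"
    using w(2) q(3,4) unfolding long_shapes_def by (intro CollectI exI[of _ k] exI[of _ m] exI[of _ "p @ q"]) auto
qed

lemma regular_long_shapes:
  assumes "finite A" "\<forall>p\<in>A. length p = 3" "regular ((\<lambda>k. replicate k gen_t) ` K)"
  shows "regular (long_shapes K A)"
proof -
  have "finite (with_neg A)" using assms(1) by (simp add: with_neg_def)
  then show ?thesis unfolding long_shapes_eq[OF assms(2)]
    by (intro regular_UN regular_conc regular_Un regular_Diff regular_star regular_sparse_tails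
        assms(3) regular_single)
qed

text \<open>The shift \<open>c\<close> is 0 for \<open>NF2\<close> and \<open>NF3\<close>, and 1 for the mirror images of \<open>NF4\<close> and
  \<open>NF5\<close>, where the inequality is strict.\<close>

definition long_forms :: "nat set \<Rightarrow> int list set \<Rightarrow> nat \<Rightarrow> letter list set" where
  "long_forms K A c = {replicate k gen_t @ N_run es @ replicate m gen_t | k m l es.
     k \<in> K \<and> length es = Suc l \<and> 3 \<le> l \<and> k + m + c \<le> l \<and> (0 < m \<longrightarrow> last es \<noteq> 0)
     \<and> N_admissible A es}"

text \<open>The letters $t$ of the word are those of the two outer powers, and the letters $t^{-1}$ are the $l$
  separators of the run; so the surplus of $t^{-1}$ over $t$ is $l - k - m$.\<close>

lemma long_forms_eq: "long_forms K A c = surplus gen_t gen_t_inv c \<inter> long_shapes K A"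
proof (intro equalityI subsetI)
  fix w assume "w \<in> surplus gen_t gen_t_inv c \<inter> long_shapes K A"
  then obtain k m es where w: "w = replicate k gen_t @ N_run es @ replicate m gen_t" "k \<in> K"
    "4 \<le> length es" "N_admissible A es" "0 < m \<longrightarrow> last es \<noteq> 0" "w \<in> surplus gen_t gen_t_inv c"
    unfolding long_shapes_def by blast
  from w(6) have "k + m + c \<le> length es - 1" by (simp add: w(1) surplus_def)
  with w(1-5) show "w \<in> long_forms K A c" unfolding long_forms_def
    by (intro CollectI exI[of _ k] exI[of _ m] exI[of _ "length es - 1"] exI[of _ es]) auto
next
  fix w assume "w \<in> long_forms K A c"
  then obtain k m l es where w: "w = replicate k gen_t @ N_run es @ replicate m gen_t" "k \<in> K"
    "length es = Suc l" "3 \<le> l" "k + m + c \<le> l" "0 < m \<longrightarrow> last es \<noteq> 0" "N_admissible A es"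
    unfolding long_forms_def by blast
  then have "w \<in> surplus gen_t gen_t_inv c" by (simp add: surplus_def)
  moreover have "w \<in> long_shapes K A" unfolding long_shapes_def
    using w by (intro CollectI exI[of _ k] exI[of _ m] exI[of _ es]) auto
  ultimately show "w \<in> surplus gen_t gen_t_inv c \<inter> long_shapes K A" by blast
qed

lemma context_free_long_forms:
  assumes "finite A" "\<forall>p\<in>A. length p = 3" "regular ((\<lambda>k. replicate k gen_t) ` K)"
  shows "context_free (long_forms K A c)"
  unfolding long_forms_eq
  by (intro context_free_Int_regular context_free_surplus regular_long_shapes assms) auto

section \<open>Reflection of words\<close>

fun flip_t :: "letter \<Rightarrow> letter" where
  "flip_t gen_t = gen_t_inv"
| "flip_t gen_t_inv = gen_t"
| "flip_t x = x"

text \<open>The letters $a^{\pm1}$ stay as they are, so this is not the formal inverse of a word: the entries of a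
  run keep their signs and are listed in the opposite order.\<close>

definition reflect :: "letter list \<Rightarrow> letter list" where
  "reflect = rev \<circ> map flip_t"

lemma reflect_append: "reflect (u @ v) = reflect v @ reflect u"
  by (simp add: reflect_def)

lemma reflect_a_pow: "reflect (a_pow e) = a_pow e"
  by (simp add: reflect_def a_pow_def)

lemma run_snoc: "es \<noteq> [] \<Longrightarrow> run s (es @ [e]) = run s es @ [s] @ a_pow e"
  by (induction s es rule: run.induct) auto

lemma reflect_N_run: "reflect (N_run es) = P_run (rev es)"
proof (induction es rule: induct_list012)
  case (3 x y es)
  have "reflect [gen_t_inv] = [gen_t]" by (simp add: reflect_def)
  then have "reflect (N_run (x # y # es)) = P_run (rev (y # es)) @ [gen_t] @ a_pow x"
    using 3(2) by (simp only: run.simps reflect_append reflect_a_pow append_assoc)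
  also have "\<dots> = P_run (rev (y # es) @ [x])" by (subst run_snoc) simp_all
  finally show ?case by simp
next
  case 1
  show ?case by (simp add: reflect_def)
next
  case 2
  show ?case by (simp add: reflect_a_pow)
qed

lemma reflect_replicate: "reflect (replicate n gen_t) = replicate n gen_t_inv"
  by (simp add: reflect_def)

lemma P_admissible_rev:
  assumes "3 \<le> length es" "with_neg B = rev ` with_neg A"
  shows "P_admissible B (rev es) \<longleftrightarrow> N_admissible A es"
proof -
  let ?n = "length es"
  have "drop (?n - 3) (rev es) = rev (take 3 es)" using assms(1) by (simp add: drop_rev)
  then have pre: "drop (?n - 3) (rev es) \<in> with_neg B \<longleftrightarrow> take 3 es \<in> with_neg A"
    using assms(2) by (auto simp: inj_image_mem_iff)
  have ent: "(\<forall>i < ?n - 3. rev es ! i \<in> {0, 1, -1}) \<longleftrightarrow> (\<forall>i. 3 \<le> i \<and> i < ?n \<longrightarrow> es ! i \<in> {0, 1, -1})"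
  proof (intro iffI allI impI)
    fix i assume H: "\<forall>i < ?n - 3. rev es ! i \<in> {0, 1, -1}" and i: "3 \<le> i \<and> i < ?n"
    have "rev es ! (?n - Suc i) = es ! i" using i by (subst rev_nth) (auto simp: Suc_diff_Suc)
    moreover have "?n - Suc i < ?n - 3" using i by auto
    ultimately show "es ! i \<in> {0, 1, -1}" using H by metis
  next
    fix i assume H: "\<forall>i. 3 \<le> i \<and> i < ?n \<longrightarrow> es ! i \<in> {0, 1, -1}" and "i < ?n - 3"
    then have "rev es ! i = es ! (?n - Suc i)" "3 \<le> ?n - Suc i \<and> ?n - Suc i < ?n"
      by (auto simp: rev_nth)
    then show "rev es ! i \<in> {0, 1, -1}" using H by metis
  qed
  have sp: "(\<forall>i < ?n - 3. rev es ! i = 0 \<or> rev es ! Suc i = 0)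
    \<longleftrightarrow> (\<forall>i. 3 \<le> Suc i \<and> Suc i < ?n \<longrightarrow> es ! i = 0 \<or> es ! Suc i = 0)"
  proof (intro iffI allI impI)
    fix i assume H: "\<forall>i < ?n - 3. rev es ! i = 0 \<or> rev es ! Suc i = 0" and i: "3 \<le> Suc i \<and> Suc i < ?n"
    define j where "j = ?n - Suc (Suc i)"
    have "rev es ! j = es ! Suc i" "rev es ! Suc j = es ! i" "j < ?n - 3"
      using i by (auto simp: rev_nth j_def Suc_diff_Suc)
    then show "es ! i = 0 \<or> es ! Suc i = 0" using H by metis
  next
    fix i assume H: "\<forall>i. 3 \<le> Suc i \<and> Suc i < ?n \<longrightarrow> es ! i = 0 \<or> es ! Suc i = 0" and i: "i < ?n - 3"
    define j where "j = ?n - Suc (Suc i)"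
    have "rev es ! i = es ! Suc j" "rev es ! Suc i = es ! j" "3 \<le> Suc j \<and> Suc j < ?n"
      using i by (auto simp: rev_nth j_def Suc_diff_Suc)
    then show "rev es ! i = 0 \<or> rev es ! Suc i = 0" using H by metis
  qed
  show ?thesis unfolding P_admissible_def N_admissible_def length_rev pre ent sp by blast
qed

text \<open>The two outer powers change places: the exponents \<open>K\<close> of $t$ in front of the $N$-run
  become the exponents of $t^{-1}$ behind the $P$-run.\<close>

lemma reflect_long_forms:
  assumes B: "with_neg B = rev ` with_neg A"
  shows "reflect ` long_forms K A c = {replicate k gen_t_inv @ P_run es @ replicate m gen_t_inv | k m l es.
     m \<in> K \<and> length es = Suc l \<and> 3 \<le> l \<and> k + m + c \<le> l \<and> (0 < k \<longrightarrow> hd es \<noteq> 0)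
     \<and> P_admissible B es}" (is "_ = ?R")
proof (intro equalityI subsetI)
  fix w assume "w \<in> reflect ` long_forms K A c"
  then obtain k m l es where w: "w = reflect (replicate k gen_t @ N_run es @ replicate m gen_t)"
    "k \<in> K" "length es = Suc l" "3 \<le> l" "k + m + c \<le> l" "0 < m \<longrightarrow> last es \<noteq> 0" "N_admissible A es"
    by (auto simp: long_forms_def)
  then show "w \<in> ?R"
    by (intro CollectI exI[of _ m] exI[of _ k] exI[of _ l] exI[of _ "rev es"])
      (auto simp: reflect_append reflect_N_run reflect_replicate P_admissible_rev[OF _ B] hd_rev)
next
  fix w assume "w \<in> ?R"
  then obtain k m l es where w: "w = replicate k gen_t_inv @ P_run es @ replicate m gen_t_inv"
    "m \<in> K" "length es = Suc l" "3 \<le> l" "k + m + c \<le> l" "0 < k \<longrightarrow> hd es \<noteq> 0" "P_admissible B es"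
    by blast
  have "w = reflect (replicate m gen_t @ N_run (rev es) @ replicate k gen_t)"
    by (simp add: w(1) reflect_append reflect_N_run reflect_replicate)
  moreover have "replicate m gen_t @ N_run (rev es) @ replicate k gen_t \<in> long_forms K A c"
    using w(2-) P_admissible_rev[of "rev es" B A, OF _ B] unfolding long_forms_def
    by (intro CollectI exI[of _ m] exI[of _ k] exI[of _ l] exI[of _ "rev es"]) (auto simp: last_rev)
  ultimately show "w \<in> reflect ` long_forms K A c" by blast
qed

section \<open>The normal forms\<close>

abbreviation X_prefixes :: "int list set" where
  "X_prefixes \<equiv> {[2,0,0], [2,0,1], [2,1,0], [3,0,0], [3,0,1], [3,0,-1], [3,1,0]}"

abbreviation N_prefixes :: "int list set" where
  "N_prefixes \<equiv> {[0,0,0], [0,0,1], [0,1,0], [1,0,0], [1,0,1], [1,0,-1], [1,1,0],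
                [2,0,0], [2,0,1], [2,0,-1], [2,1,0], [3,0,0], [3,0,1], [3,0,-1], [3,1,0]}"

lemma finite_listset: "\<forall>A \<in> set As. finite A \<Longrightarrow> finite (listset As)"
proof (induction As)
  case (Cons A As)
  have "set_Cons A (listset As) = (\<lambda>(x, xs). x # xs) ` (A \<times> listset As)"
    by (auto simp: set_Cons_def)
  with Cons show ?case by simp
qed simp

lemma finite_pm: "finite (pm x)"
  by (simp add: pm_def)

lemma finite_short_words: "finite L1" "finite L2" "finite L3" "finite L4"
  unfolding L1_def L2_def L3_def L4_def
  by (intro finite_UnI finite_imageI finite_UN_I finite_listset finite.intros ballI;
      (auto intro: finite_pm)?)+

lemma NF2_eq: "NF2 = long_forms {0<..} X_prefixes 0 \<union> (NF2 \<inter> L1)"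
proof -
  have "long_forms {0<..} X_prefixes 0 \<subseteq> NF2"
  proof
    fix w assume "w \<in> long_forms {0<..} X_prefixes 0"
    then obtain k m l es where w: "w = replicate k gen_t @ N_run es @ replicate m gen_t"
      "0 < k" "length es = Suc l" "3 \<le> l" "k + m \<le> l" "0 < m \<longrightarrow> last es \<noteq> 0"
      "N_admissible X_prefixes es"
      unfolding long_forms_def by auto
    then show "w \<in> NF2" unfolding NF2_def
      by (intro CollectI exI[of _ k] exI[of _ m] exI[of _ l] exI[of _ es]) simp
  qed
  moreover have "NF2 \<subseteq> long_forms {0<..} X_prefixes 0 \<union> L1"
  proof
    fix w assume "w \<in> NF2"
    then obtain k m l es where w: "w = replicate k gen_t @ N_run es @ replicate m gen_t"
      "length es = Suc l" "0 < k" "k + m \<le> l" "0 < m \<longrightarrow> last es \<noteq> 0"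
      "if 3 \<le> l then N_admissible X_prefixes es else w \<in> L1"
      unfolding NF2_def by blast
    show "w \<in> long_forms {0<..} X_prefixes 0 \<union> L1"
    proof (cases "3 \<le> l")
      case True
      then have "w \<in> long_forms {0<..} X_prefixes 0"
        using w unfolding long_forms_def by (intro CollectI exI[of _ k] exI[of _ m] exI[of _ l] exI[of _ es]) simp
      then show ?thesis by blast
    qed (use w(6) in simp)
  qed
  ultimately show ?thesis by blast
qed

lemma NF3_eq: "NF3 = long_forms {0} N_prefixes 0 \<union> (NF3 \<inter> L2)"
proof -
  have "long_forms {0} N_prefixes 0 \<subseteq> NF3"
  proof
    fix w assume "w \<in> long_forms {0} N_prefixes 0"
    then obtain m l es where w: "w = N_run es @ replicate m gen_t"
      "length es = Suc l" "3 \<le> l" "m \<le> l" "0 < m \<longrightarrow> last es \<noteq> 0" "N_admissible N_prefixes es"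
      unfolding long_forms_def by auto
    then show "w \<in> NF3" unfolding NF3_def
      by (intro CollectI exI[of _ m] exI[of _ l] exI[of _ es]) simp
  qed
  moreover have "NF3 \<subseteq> long_forms {0} N_prefixes 0 \<union> L2"
  proof
    fix w assume "w \<in> NF3"
    then obtain k l es where w: "w = N_run es @ replicate k gen_t"
      "length es = Suc l" "k \<le> l" "0 < k \<longrightarrow> last es \<noteq> 0"
      "if 3 \<le> l then N_admissible N_prefixes es else w \<in> L2"
      unfolding NF3_def by blast
    show "w \<in> long_forms {0} N_prefixes 0 \<union> L2"
    proof (cases "3 \<le> l")
      case True
      then have "w \<in> long_forms {0} N_prefixes 0"
        using w unfolding long_forms_def by (intro CollectI exI[of _ 0] exI[of _ k] exI[of _ l] exI[of _ es]) simp
      then show ?thesis by blast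
    qed (use w(5) in simp)
  qed
  ultimately show ?thesis by blast
qed

abbreviation X_suffixes :: "int list set" where
  "X_suffixes \<equiv> {[0,0,2], [1,0,2], [0,1,2], [0,0,3], [1,0,3], [-1,0,3], [0,1,3]}"

abbreviation P_suffixes :: "int list set" where
  "P_suffixes \<equiv> {[0,0,0], [1,0,0], [0,1,0], [0,0,1], [1,0,1], [-1,0,1], [0,1,1],
      [0,0,2], [1,0,2], [-1,0,2], [0,1,2], [0,0,3], [1,0,3], [-1,0,3], [0,1,3]}"

lemma rev_X_prefixes: "with_neg X_suffixes = rev ` with_neg X_prefixes"
  unfolding with_neg_def by (rule equalityI; simp)

lemma rev_N_prefixes: "with_neg P_suffixes = rev ` with_neg N_prefixes"
  unfolding with_neg_def by (rule equalityI; simp)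

lemma NF4_eq: "NF4 = reflect ` long_forms {0} N_prefixes 1 \<union> (NF4 \<inter> L3)" (is "_ = ?F \<union> _")
proof -
  note F = reflect_long_forms[OF rev_N_prefixes, of "{0}" 1]
  have "?F \<subseteq> NF4"
  proof
    fix w assume "w \<in> ?F"
    then obtain k l es where w: "w = replicate k gen_t_inv @ P_run es"
      "length es = Suc l" "3 \<le> l" "k < l" "0 < k \<longrightarrow> hd es \<noteq> 0" "P_admissible P_suffixes es"
      unfolding F by auto
    then show "w \<in> NF4" unfolding NF4_def
      by (intro CollectI exI[of _ k] exI[of _ l] exI[of _ es]) simp
  qed
  moreover have "NF4 \<subseteq> ?F \<union> L3"
  proof
    fix w assume "w \<in> NF4"
    then obtain k l es where w: "w = replicate k gen_t_inv @ P_run es"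
      "length es = Suc l" "k < l" "0 < k \<longrightarrow> hd es \<noteq> 0"
      "if 3 \<le> l then P_admissible P_suffixes es else w \<in> L3"
      unfolding NF4_def by blast
    show "w \<in> ?F \<union> L3"
    proof (cases "3 \<le> l")
      case True
      then have "w \<in> ?F"
        using w unfolding F by (intro CollectI exI[of _ k] exI[of _ 0] exI[of _ l] exI[of _ es]) simp
      then show ?thesis by blast
    qed (use w(5) in simp)
  qed
  ultimately show ?thesis by blast
qed

lemma NF5_eq: "NF5 = reflect ` long_forms {0<..} X_prefixes 1 \<union> (NF5 \<inter> L4)" (is "_ = ?F \<union> _")
proof -
  note F = reflect_long_forms[OF rev_X_prefixes, of "{0<..}" 1]
  have "?F \<subseteq> NF5"
  proof
    fix w assume "w \<in> ?F"
    then obtain k m l es where w: "w = replicate k gen_t_inv @ P_run es @ replicate m gen_t_inv"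
      "length es = Suc l" "3 \<le> l" "m \<in> {0<..}" "k + m + 1 \<le> l" "0 < k \<longrightarrow> hd es \<noteq> 0"
      "P_admissible X_suffixes es"
      unfolding F by blast
    then show "w \<in> NF5" unfolding NF5_def
      by (intro CollectI exI[of _ k] exI[of _ m] exI[of _ l] exI[of _ es]) simp
  qed
  moreover have "NF5 \<subseteq> ?F \<union> L4"
  proof
    fix w assume "w \<in> NF5"
    then obtain k m l es where w: "w = replicate k gen_t_inv @ P_run es @ replicate m gen_t_inv"
      "length es = Suc l" "0 < m" "k + m < l" "0 < k \<longrightarrow> hd es \<noteq> 0"
      "if 3 \<le> l then P_admissible X_suffixes es else w \<in> L4"
      unfolding NF5_def by blast
    show "w \<in> ?F \<union> L4"
    proof (cases "3 \<le> l")
      case True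
      then have "w \<in> ?F"
        using w unfolding F by (intro CollectI exI[of _ k] exI[of _ m] exI[of _ l] exI[of _ es]) simp
      then show ?thesis by blast
    qed (use w(6) in simp)
  qed
  ultimately show ?thesis by blast
qed

lemma context_free_long_normal_forms:
  "context_free (long_forms {0} N_prefixes c)" "context_free (long_forms {0<..} X_prefixes c)"
proof -
  show "context_free (long_forms {0} N_prefixes c)"
    by (intro context_free_long_forms) (auto intro: regular_single)
  have "replicate k gen_t \<in> {[gen_t]} @@ star {[gen_t]}" if "0 < k" for k
    using that concI[of "[gen_t]" "{[gen_t]}" "replicate (k - 1) gen_t" "star {[gen_t]}"]
    by (cases k) (auto simp: star_letter)
  moreover have "[gen_t] @ replicate n gen_t \<in> (\<lambda>k. replicate k gen_t) ` {0<..}" for n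
    by (intro image_eqI[of _ _ "Suc n"]) auto
  ultimately have "(\<lambda>k. replicate k gen_t) ` {0<..} = {[gen_t]} @@ star {[gen_t]}"
    by (auto simp: star_letter elim!: concE)
  then show "context_free (long_forms {0<..} X_prefixes c)"
    by (intro context_free_long_forms) (auto intro: regular_single regular_star regular_conc)
qed

theorem corollary4:
  shows "context_free NF"
proof -
  have refl: "context_free (reflect ` L)" if "context_free L" for L
    unfolding reflect_def using that by (rule context_free_rev_map)
  have fin: "context_free (M \<inter> L)" if "finite L" for M L :: "letter list set"
    using that by (intro context_free_finite) simp
  have "context_free NF1" unfolding NF1_def by (intro context_free_finite) simp
  moreover have "context_free NF2" "context_free NF3" "context_free NF4" "context_free NF5"
    by (subst NF2_eq NF3_eq NF4_eq NF5_eq,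
        intro context_free_Un refl fin finite_short_words context_free_long_normal_forms)+
  ultimately show ?thesis unfolding NF_def by (intro context_free_Un)
qed

end
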